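(* For $n\ge1$ and $i\in\{1,\dots,n\}$ let $H^{(n)}_i:=\{(g^{(n)}_i)^l:l\in\mathbb Z\}\subset\mathbb F_n$. For $n,m\ge1$ let $G_{n,m}:=\ker\phi_{n,m}$, where $\phi_{n,m}:\mathbb F_{nm}\to\mathbb F_n\times\mathbb F_m$ is the group homomorphism with $\phi_{n,m}(g^{(nm)}_{m(i-1)+j})=(g^{(n)}_i,g^{(m)}_j)$ for $1\le i\le n$, $1\le j\le m$. Define the subgroup $K_{n,m,l}:=G_{n,m}H^{(nm)}_l$ of $\mathbb F_{nm}$ for $l=1,\dots,nm$. (i) For $n,m\ge1$ and $(i,j)\in\{1,\dots,n\}\times\{1,\dots,m\}$, $$\lambda_{\mathbb F_n/H^{(n)}_i}\otimes_\varphi\lambda_{\mathbb F_m/H^{(m)}_j}\cong\lambda_{\mathbb F_{nm}/K_{n,m,m(i-1)+j}}$$ (unitary equivalence). (ii) For any $l=1,\dots,nm$, $\lambda_{\mathbb F_{nm}/K_{n,m,l}}$ is irreducible. (iii) For $l,l'\in\{1,\dots,nm\}$, $\lambda_{\mathbb F_{nm}/K_{n,m,l}}$ and $\lambda_{\mathbb F_{nm}/K_{n,m,l'}}$ are unitarily equivalent if and only if $l=l'$.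
   Context: $\mathbb F_n$ is the free group of rank $n$ with free generators $g^{(n)}_1,\dots,g^{(n)}_n$. For a discrete group $\Gamma$ and a subgroup $\Gamma_0$, $\Gamma/\Gamma_0$ is the left coset space and the quasi-regular representation $\lambda_{\Gamma/\Gamma_0}$ is the unitary representation of $\Gamma$ on $\ell^2(\Gamma/\Gamma_0)$ given by the natural left action of $\Gamma$ on the standard basis. For unitary representations $\pi$ of $\mathbb F_n$ and $\pi'$ of $\mathbb F_m$, $\pi\otimes_\varphi\pi'$ is the unitary representation of $\mathbb F_{nm}$ defined by $\pi\otimes_\varphi\pi':=(\pi\otimes\pi')\circ\varphi_{n,m}$, where $\varphi_{n,m}:C^*(\mathbb F_{nm})\to C^*(\mathbb F_n)\otimes C^*(\mathbb F_m)$ is the unital $*$-homomorphism of full group C$^*$-algebras (minimal tensor product) with $\varphi_{n,m}(g^{(nm)}_{m(i-1)+j})=g^{(n)}_i\otimes g^{(m)}_j$; that is, $(\pi\otimes_\varphi\pi')(g)=\pi(g')\otimes\pi'(g'')$ with $(g',g'')=\phi_{n,m}(g)$. *)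

theory Defs
  imports "HOL-Algebra.Left_Coset" "HOL-Algebra.Zassenhaus" "HOL-Algebra.Generated_Groups"
    "HOL-Analysis.Infinite_Sum" "HOL-Library.Poly_Mapping"
begin

section \<open>Free groups\<close>

text \<open>A letter \<open>(i, True)\<close> stands for the free generator with index \<open>i\<close>, and \<open>(i, False)\<close> for
  its inverse. Group elements are the reduced words.\<close>

type_synonym 'a word = "('a \<times> bool) list"

definition inv_letter :: "'a \<times> bool \<Rightarrow> 'a \<times> bool" where
  "inv_letter a = (fst a, \<not> snd a)"

fun reduced :: "'a word \<Rightarrow> bool" where
  "reduced [] = True"
| "reduced [a] = True"
| "reduced (a # b # w) = (b \<noteq> inv_letter a \<and> reduced (b # w))"

fun red_cons :: "'a \<times> bool \<Rightarrow> 'a word \<Rightarrow> 'a word" where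
  "red_cons a [] = [a]"
| "red_cons a (b # w) = (if b = inv_letter a then w else a # b # w)"

definition free_group :: "'a set \<Rightarrow> 'a word monoid" where
  "free_group S = \<lparr>carrier = {w. fst ` set w \<subseteq> S \<and> reduced w},
                   monoid.mult = (\<lambda>u v. foldr red_cons u v), one = []\<rparr>"

definition gen :: "'a \<Rightarrow> 'a word" where
  "gen i = [(i, True)]"

lemma inv_letter_inv [simp]: "inv_letter (inv_letter a) = a"
  by (simp add: inv_letter_def)

lemma inv_letter_neq [simp]: "inv_letter a \<noteq> a" "a \<noteq> inv_letter a"
  by (auto simp: inv_letter_def prod_eq_iff)

lemma fst_inv_letter [simp]: "fst (inv_letter a) = fst a"
  by (simp add: inv_letter_def)

lemma reduced_tl: "reduced (a # w) \<Longrightarrow> reduced w"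
  by (cases w) auto

lemma reduced_red_cons: "reduced w \<Longrightarrow> reduced (red_cons a w)"
  by (cases w) (auto dest: reduced_tl)

lemma set_red_cons: "fst ` set (red_cons a w) \<subseteq> insert (fst a) (fst ` set w)"
  by (cases w) auto

lemma red_cons_cancel: "reduced w \<Longrightarrow> red_cons (inv_letter a) (red_cons a w) = w"
proof (cases w)
  case (Cons b u)
  assume "reduced w"
  with Cons show ?thesis by (cases u) auto
qed auto

lemma red_cons_cancel': "reduced w \<Longrightarrow> red_cons a (red_cons (inv_letter a) w) = w"
  using red_cons_cancel[of w "inv_letter a"] by simp

lemma reduced_foldr: "reduced v \<Longrightarrow> reduced (foldr red_cons u v)"
  by (induction u) (auto simp: reduced_red_cons)

lemma set_foldr: "fst ` set (foldr red_cons u v) \<subseteq> fst ` set u \<union> fst ` set v"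
proof (induction u)
  case (Cons a u)
  show ?case using subset_trans[OF set_red_cons[of a "foldr red_cons u v"] insert_mono[OF Cons]] by simp
qed auto

lemma foldr_red_cons:
  assumes "reduced v"
  shows "foldr red_cons (red_cons a u) v = red_cons a (foldr red_cons u v)"
proof (cases u)
  case (Cons b u')
  then show ?thesis
    using red_cons_cancel'[OF reduced_foldr[OF assms], of a u'] by auto
qed auto

lemma foldr_assoc:
  "reduced w \<Longrightarrow> foldr red_cons (foldr red_cons u v) w = foldr red_cons u (foldr red_cons v w)"
  by (induction u) (auto simp: foldr_red_cons)

lemma foldr_Nil: "reduced u \<Longrightarrow> foldr red_cons u [] = u"
proof (induction u)
  case (Cons a u)
  then show ?case by (cases u) (auto dest: reduced_tl)
qed auto

lemma foldr_left_inv: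
  "reduced v \<Longrightarrow> foldr red_cons (rev (map inv_letter u)) (foldr red_cons u v) = v"
  by (induction u arbitrary: v) (auto simp: red_cons_cancel reduced_foldr)

lemma group_free_group: "group (free_group S)"
proof (rule groupI)
  fix x assume x: "x \<in> carrier (free_group S)"
  let ?y = "foldr red_cons (rev (map inv_letter x)) []"
  have "fst ` set ?y \<subseteq> S"
    using subset_trans[OF set_foldr[of "rev (map inv_letter x)" "[]"]] x
    by (simp add: free_group_def image_image)
  moreover have "foldr red_cons ?y x = []"
    using x foldr_left_inv[of "[]" x] by (simp add: free_group_def foldr_assoc foldr_Nil)
  ultimately show "\<exists>y\<in>carrier (free_group S). y \<otimes>\<^bsub>free_group S\<^esub> x = \<one>\<^bsub>free_group S\<^esub>"
    by (intro bexI[of _ ?y]) (auto simp: free_group_def reduced_foldr)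
next
  fix x y assume "x \<in> carrier (free_group S)" "y \<in> carrier (free_group S)"
  then show "x \<otimes>\<^bsub>free_group S\<^esub> y \<in> carrier (free_group S)"
    using subset_trans[OF set_foldr[of x y], of S] by (simp add: free_group_def reduced_foldr)
qed (auto simp: free_group_def foldr_assoc)

lemma gen_in_free_group: "i \<in> S \<Longrightarrow> gen i \<in> carrier (free_group S)"
  by (simp add: gen_def free_group_def)

definition letter_image :: "('b, 'z) monoid_scheme \<Rightarrow> ('a \<Rightarrow> 'b) \<Rightarrow> 'a \<times> bool \<Rightarrow> 'b" where
  "letter_image G f a = (if snd a then f (fst a) else inv\<^bsub>G\<^esub> f (fst a))"

text \<open>The homomorphism from the free group determined by the images \<open>f i\<close> of the generators.\<close>

definition free_lift :: "('b, 'z) monoid_scheme \<Rightarrow> ('a \<Rightarrow> 'b) \<Rightarrow> 'a word \<Rightarrow> 'b" where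
  "free_lift G f w = foldr (\<lambda>a x. letter_image G f a \<otimes>\<^bsub>G\<^esub> x) w \<one>\<^bsub>G\<^esub>"

lemma free_lift_simps [simp]:
  "free_lift G f [] = \<one>\<^bsub>G\<^esub>"
  "free_lift G f (a # w) = letter_image G f a \<otimes>\<^bsub>G\<^esub> free_lift G f w"
  by (simp_all add: free_lift_def)

lemma letter_image_closed:
  assumes "group G" "\<And>i. i \<in> S \<Longrightarrow> f i \<in> carrier G" "fst a \<in> S"
  shows "letter_image G f a \<in> carrier G"
  using assms by (simp add: letter_image_def group.inv_closed)

lemma free_lift_closed:
  assumes "group G" "\<And>i. i \<in> S \<Longrightarrow> f i \<in> carrier G" "fst ` set w \<subseteq> S"
  shows "free_lift G f w \<in> carrier G"
proof -
  interpret group G by fact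
  show ?thesis using assms(3)
    by (induction w) (auto intro!: letter_image_closed[where S = S, OF assms(1,2)])
qed

lemma free_lift_red_cons:
  assumes G: "group G" and f: "\<And>i. i \<in> S \<Longrightarrow> f i \<in> carrier G"
    and "fst a \<in> S" "fst ` set w \<subseteq> S"
  shows "free_lift G f (red_cons a w) = letter_image G f a \<otimes>\<^bsub>G\<^esub> free_lift G f w"
proof (cases w)
  case (Cons b u)
  interpret group G by fact
  have u: "free_lift G f u \<in> carrier G" and a: "f (fst a) \<in> carrier G"
    using assms Cons by (auto intro!: free_lift_closed[OF G, where S = S])
  show ?thesis
  proof (cases "b = inv_letter a")
    case True
    have "letter_image G f a \<otimes>\<^bsub>G\<^esub> letter_image G f b = \<one>\<^bsub>G\<^esub>"
      using a by (auto simp: letter_image_def True inv_letter_def)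
    moreover have "letter_image G f a \<in> carrier G" "letter_image G f b \<in> carrier G"
      using letter_image_closed[where S = S and f = f, OF G f] assms(3) True by simp_all
    ultimately show ?thesis
      using Cons True u m_assoc[of "letter_image G f a" "letter_image G f b" "free_lift G f u"]
      by simp
  qed (use Cons in auto)
qed auto

lemma free_lift_hom:
  assumes G: "group G" and f: "\<And>i. i \<in> S \<Longrightarrow> f i \<in> carrier G"
  shows "free_lift G f \<in> hom (free_group S) G"
proof (rule homI)
  interpret group G by fact
  fix x assume "x \<in> carrier (free_group S)"
  then show "free_lift G f x \<in> carrier G"
    using free_lift_closed[where S = S and w = x, OF G f] by (auto simp: free_group_def)
  fix y assume y: "y \<in> carrier (free_group S)"
  have "fst ` set x \<subseteq> S" using \<open>x \<in> _\<close> by (simp add: free_group_def)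
  then have "free_lift G f (foldr red_cons x y) = free_lift G f x \<otimes>\<^bsub>G\<^esub> free_lift G f y"
  proof (induction x)
    case Nil
    then show ?case using y free_lift_closed[where S = S and w = y, OF G f] by (simp add: free_group_def)
  next
    case (Cons a x)
    have "fst ` set (foldr red_cons x y) \<subseteq> S"
      using subset_trans[OF set_foldr[of x y], of S] Cons.prems y by (simp add: free_group_def)
    with Cons y show ?case
      using free_lift_red_cons[where S = S and a = a and w = "foldr red_cons x y", OF G f]
        letter_image_closed[where S = S and a = a, OF G f]
        free_lift_closed[where S = S and w = x, OF G f] free_lift_closed[where S = S and w = y, OF G f]
      by (simp add: free_group_def m_assoc)
  qed
  then show "free_lift G f (x \<otimes>\<^bsub>free_group S\<^esub> y) = free_lift G f x \<otimes>\<^bsub>G\<^esub> free_lift G f y"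
    by (simp add: free_group_def)
qed

lemma free_lift_gen: "group G \<Longrightarrow> f i \<in> carrier G \<Longrightarrow> free_lift G f (gen i) = f i"
  by (simp add: gen_def letter_image_def group.is_monoid monoid.r_one)

lemma free_lift_unique:
  assumes G: "group G" and h: "h \<in> hom (free_group S) G"
    and hf: "\<And>i. i \<in> S \<Longrightarrow> h (gen i) = f i" and w: "w \<in> carrier (free_group S)"
  shows "h w = free_lift G f w"
proof -
  interpret F: group "free_group S" by (rule group_free_group)
  interpret h: group_hom "free_group S" G h
    using G h by (intro group_hom.intro group_hom_axioms.intro F.group_axioms)
  have letter: "h [a] = letter_image G f a" if "fst a \<in> S" for a
  proof (cases "snd a")
    case True
    then show ?thesis using hf[OF that] by (cases a) (simp add: gen_def letter_image_def)
  next
    case False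
    have "[a] \<otimes>\<^bsub>free_group S\<^esub> gen (fst a) = \<one>\<^bsub>free_group S\<^esub>"
      using False by (simp add: gen_def free_group_def inv_letter_def prod_eq_iff)
    moreover have "[a] \<in> carrier (free_group S)" using that by (simp add: free_group_def)
    ultimately have "[a] = inv\<^bsub>free_group S\<^esub> gen (fst a)"
      using F.inv_equality gen_in_free_group[OF that] by metis
    then show ?thesis
      using False hf[OF that] gen_in_free_group[OF that] by (simp add: letter_image_def)
  qed
  have "fst ` set w \<subseteq> S \<Longrightarrow> reduced w \<Longrightarrow> h w = free_lift G f w"
  proof (induction w)
    case Nil
    then show ?case using h.hom_one by (simp add: free_group_def)
  next
    case (Cons a w)
    have aw: "[a] \<in> carrier (free_group S)" "w \<in> carrier (free_group S)"
      using Cons.prems by (auto simp: free_group_def dest: reduced_tl)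
    have "a # w = [a] \<otimes>\<^bsub>free_group S\<^esub> w"
      using Cons.prems by (cases w) (auto simp: free_group_def)
    then have "h (a # w) = h [a] \<otimes>\<^bsub>G\<^esub> h w" using h.hom_mult[OF aw] by simp
    then show ?case using Cons letter[of a] reduced_tl[of a w] by simp
  qed
  with w show ?thesis by (simp add: free_group_def)
qed


section \<open>The subgroups\<close>

abbreviation FF :: "nat \<Rightarrow> nat word monoid" where
  "FF n \<equiv> free_group {1..n}"

definition Hsub :: "nat \<Rightarrow> nat \<Rightarrow> nat word set" where
  "Hsub n i = {gen i [^]\<^bsub>FF n\<^esub> l | l :: int. True}"

text \<open>The generator with index \<open>k = m * (i - 1) + j\<close>, where \<open>1 \<le> j \<le> m\<close>, is sent to the pair of the
  generators with indices \<open>i = (k - 1) div m + 1\<close> and \<open>j = (k - 1) mod m + 1\<close>; see \<open>phi_gen\<close>.\<close>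

definition phi :: "nat \<Rightarrow> nat \<Rightarrow> nat word \<Rightarrow> nat word \<times> nat word" where
  "phi n m = free_lift (FF n \<times>\<times> FF m) (\<lambda>k. (gen ((k - 1) div m + 1), gen ((k - 1) mod m + 1)))"

definition Gker :: "nat \<Rightarrow> nat \<Rightarrow> nat word set" where
  "Gker n m = kernel (FF (n * m)) (FF n \<times>\<times> FF m) (phi n m)"

definition Ksub :: "nat \<Rightarrow> nat \<Rightarrow> nat \<Rightarrow> nat word set" where
  "Ksub n m l = Gker n m <#>\<^bsub>FF (n * m)\<^esub> Hsub (n * m) l"

lemma phi_index:
  fixes k n m :: nat
  assumes "k \<in> {1..n * m}"
  shows "(k - 1) div m + 1 \<in> {1..n}" "(k - 1) mod m + 1 \<in> {1..m}"
proof -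
  have m: "m > 0" using assms by (cases "m = 0") auto
  have "k - 1 < n * m" using assms by auto
  then show "(k - 1) div m + 1 \<in> {1..n}" using less_mult_imp_div_less by fastforce
  show "(k - 1) mod m + 1 \<in> {1..m}" using m by (simp add: Suc_leI)
qed

lemma phi_hom: "phi n m \<in> hom (FF (n * m)) (FF n \<times>\<times> FF m)"
  unfolding phi_def
proof (rule free_lift_hom)
  show "group (FF n \<times>\<times> FF m)" by (intro DirProd_group group_free_group)
  fix k assume "k \<in> {1..n * m}"
  then show "(gen ((k - 1) div m + 1), gen ((k - 1) mod m + 1)) \<in> carrier (FF n \<times>\<times> FF m)"
    using phi_index[of k n m, THEN gen_in_free_group] by (simp add: DirProd_def)
qed

lemma phi_gen:
  assumes "i \<in> {1..n}" "j \<in> {1..m}"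
  shows "m * (i - 1) + j \<in> {1..n * m}" "phi n m (gen (m * (i - 1) + j)) = (gen i, gen j)"
proof -
  obtain a where i: "i = Suc a" "a < n" using assms(1) by (cases i) auto
  obtain b where j: "j = Suc b" "b < m" using assms(2) by (cases j) auto
  have "m * Suc a \<le> m * n" using i by (intro mult_le_mono) auto
  then show "m * (i - 1) + j \<in> {1..n * m}" using i j by (simp add: mult.commute)
  have "group (FF n \<times>\<times> FF m)" by (intro DirProd_group group_free_group)
  then show "phi n m (gen (m * (i - 1) + j)) = (gen i, gen j)"
    using assms i j gen_in_free_group[of i "{1..n}"] gen_in_free_group[of j "{1..m}"]
    unfolding phi_def by (subst free_lift_gen) auto
qed

lemma subgroup_Hsub:
  assumes "i \<in> {1..n}"
  shows "subgroup (Hsub n i) (FF n)"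
proof -
  interpret group "FF n" by (rule group_free_group)
  have "Hsub n i = generate (FF n) {gen i}"
    unfolding Hsub_def by (subst generate_pow[OF gen_in_free_group[OF assms]]) simp
  then show ?thesis using generate_is_subgroup[of "{gen i}"] gen_in_free_group[OF assms] by simp
qed

lemma subgroup_Ksub:
  assumes "l \<in> {1..n * m}"
  shows "subgroup (Ksub n m l) (FF (n * m))"
proof -
  interpret group_hom "FF (n * m)" "FF n \<times>\<times> FF m" "phi n m"
    by (intro group_hom.intro group_hom_axioms.intro group_free_group DirProd_group phi_hom)
  show ?thesis
    unfolding Ksub_def Gker_def
    by (rule G.mult_norm_subgroup[OF normal_kernel subgroup_Hsub[OF assms]])
qed


section \<open>Hilbert spaces\<close>

text \<open>Complex Hilbert spaces with an explicit carrier; the inner product \<open>ip\<close> is linear in its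
  second argument.\<close>

record 'v hspace = "'v partial_object" +
  vadd :: "'v \<Rightarrow> 'v \<Rightarrow> 'v"
  vzero :: 'v
  vscale :: "complex \<Rightarrow> 'v \<Rightarrow> 'v"
  ip :: "'v \<Rightarrow> 'v \<Rightarrow> complex"

definition vdist :: "'v hspace \<Rightarrow> 'v \<Rightarrow> 'v \<Rightarrow> real" where
  "vdist V v w = (let d = vadd V v (vscale V (- 1) w) in sqrt (Re (ip V d d)))"

definition cauchy_seq :: "'v hspace \<Rightarrow> (nat \<Rightarrow> 'v) \<Rightarrow> bool" where
  "cauchy_seq V s \<longleftrightarrow> (\<forall>n. s n \<in> carrier V) \<and>
     (\<forall>e>0. \<exists>N. \<forall>p\<ge>N. \<forall>q\<ge>N. vdist V (s p) (s q) < e)"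

locale hilbert_space =
  fixes V :: "'v hspace"
  assumes add_group: "comm_group \<lparr>carrier = carrier V, monoid.mult = vadd V, one = vzero V\<rparr>"
    and scale_closed: "v \<in> carrier V \<Longrightarrow> vscale V c v \<in> carrier V"
    and scale_add: "\<lbrakk>v \<in> carrier V; w \<in> carrier V\<rbrakk> \<Longrightarrow>
          vscale V c (vadd V v w) = vadd V (vscale V c v) (vscale V c w)"
    and add_scale: "v \<in> carrier V \<Longrightarrow>
          vscale V (c + d) v = vadd V (vscale V c v) (vscale V d v)"
    and scale_scale: "v \<in> carrier V \<Longrightarrow> vscale V c (vscale V d v) = vscale V (c * d) v"
    and scale_one: "v \<in> carrier V \<Longrightarrow> vscale V 1 v = v"
    and ip_add: "\<lbrakk>u \<in> carrier V; v \<in> carrier V; w \<in> carrier V\<rbrakk> \<Longrightarrow>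
          ip V u (vadd V v w) = ip V u v + ip V u w"
    and ip_scale: "\<lbrakk>u \<in> carrier V; v \<in> carrier V\<rbrakk> \<Longrightarrow> ip V u (vscale V c v) = c * ip V u v"
    and ip_cnj: "\<lbrakk>u \<in> carrier V; v \<in> carrier V\<rbrakk> \<Longrightarrow> ip V v u = cnj (ip V u v)"
    and ip_nonneg: "v \<in> carrier V \<Longrightarrow> 0 \<le> Re (ip V v v)"
    and ip_definite: "\<lbrakk>v \<in> carrier V; ip V v v = 0\<rbrakk> \<Longrightarrow> v = vzero V"
    and complete: "cauchy_seq V s \<Longrightarrow> \<exists>v\<in>carrier V. (\<lambda>n. vdist V (s n) v) \<longlonglongrightarrow> 0"

definition unitary_map :: "'v hspace \<Rightarrow> 'w hspace \<Rightarrow> ('v \<Rightarrow> 'w) \<Rightarrow> bool" where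
  "unitary_map V W U \<longleftrightarrow> bij_betw U (carrier V) (carrier W) \<and>
     (\<forall>v\<in>carrier V. \<forall>w\<in>carrier V. U (vadd V v w) = vadd W (U v) (U w)) \<and>
     (\<forall>c. \<forall>v\<in>carrier V. U (vscale V c v) = vscale W c (U v)) \<and>
     (\<forall>v\<in>carrier V. \<forall>w\<in>carrier V. ip W (U v) (U w) = ip V v w)"

definition closed_subspace :: "'v hspace \<Rightarrow> 'v set \<Rightarrow> bool" where
  "closed_subspace V W \<longleftrightarrow> W \<subseteq> carrier V \<and> vzero V \<in> W \<and>
     (\<forall>v\<in>W. \<forall>w\<in>W. vadd V v w \<in> W) \<and> (\<forall>c. \<forall>v\<in>W. vscale V c v \<in> W) \<and>
     (\<forall>s. \<forall>v\<in>carrier V. (\<forall>n. s n \<in> W) \<and> (\<lambda>n. vdist V (s n) v) \<longlonglongrightarrow> 0 \<longrightarrow> v \<in> W)"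

definition ell2 :: "'x set \<Rightarrow> ('x \<Rightarrow> complex) hspace" where
  "ell2 X = \<lparr>carrier = {f. (\<forall>x. x \<notin> X \<longrightarrow> f x = 0) \<and> (\<lambda>x. (cmod (f x))\<^sup>2) summable_on X},
             vadd = (\<lambda>f g x. f x + g x), vzero = (\<lambda>x. 0), vscale = (\<lambda>c f x. c * f x),
             ip = (\<lambda>f g. \<Sum>\<^sub>\<infinity>x\<in>X. cnj (f x) * g x)\<rparr>"


section \<open>Hilbert tensor products\<close>

text \<open>The (separated) completion of a space with a positive semidefinite inner product: classes of
  Cauchy sequences modulo null sequences.\<close>

definition null_rel :: "'v hspace \<Rightarrow> (nat \<Rightarrow> 'v) rel" where
  "null_rel V = {(s, t). cauchy_seq V s \<and> cauchy_seq V t \<and> (\<lambda>n. vdist V (s n) (t n)) \<longlonglongrightarrow> 0}"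

definition completion :: "'v hspace \<Rightarrow> (nat \<Rightarrow> 'v) set hspace" where
  "completion V = \<lparr>carrier = Collect (cauchy_seq V) // null_rel V,
     vadd = (\<lambda>A B. \<Union>a\<in>A. \<Union>b\<in>B. null_rel V `` {\<lambda>n. vadd V (a n) (b n)}),
     vzero = null_rel V `` {\<lambda>n. vzero V},
     vscale = (\<lambda>c A. \<Union>a\<in>A. null_rel V `` {\<lambda>n. vscale V c (a n)}),
     ip = (\<lambda>A B. THE z. \<forall>a\<in>A. \<forall>b\<in>B. (\<lambda>n. ip V (a n) (b n)) \<longlonglongrightarrow> z)\<rparr>"

definition completion_map :: "'v hspace \<Rightarrow> ('v \<Rightarrow> 'v) \<Rightarrow> (nat \<Rightarrow> 'v) set \<Rightarrow> (nat \<Rightarrow> 'v) set" where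
  "completion_map V T A = (\<Union>a\<in>A. null_rel V `` {\<lambda>n. T (a n)})"

text \<open>The algebraic tensor product of \<open>V\<close> and \<open>W\<close>, presented by formal linear combinations of
  pairs \<open>(v, w)\<close> (standing for the elementary tensors) with the semidefinite inner product
  determined by \<open>\<langle>(v, w), (v', w')\<rangle> = \<langle>v, v'\<rangle> \<langle>w, w'\<rangle>\<close>. Its null vectors are the combinations that
  vanish in the algebraic tensor product, i.e. the span of the bilinearity relations; they are
  divided out in the completion.\<close>

definition alg_tensor :: "'v hspace \<Rightarrow> 'w hspace \<Rightarrow> ('v \<times> 'w \<Rightarrow>\<^sub>0 complex) hspace" where
  "alg_tensor V W = \<lparr>carrier = {a. Poly_Mapping.keys a \<subseteq> carrier V \<times> carrier W},
     vadd = (+), vzero = 0, vscale = (\<lambda>c. Poly_Mapping.map ((*) c)),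
     ip = (\<lambda>a b. \<Sum>p\<in>Poly_Mapping.keys a. \<Sum>q\<in>Poly_Mapping.keys b.
             cnj (Poly_Mapping.lookup a p) * Poly_Mapping.lookup b q *
             (ip V (fst p) (fst q) * ip W (snd p) (snd q)))\<rparr>"

definition hilbert_tensor :: "'v hspace \<Rightarrow> 'w hspace \<Rightarrow> (nat \<Rightarrow> ('v \<times> 'w \<Rightarrow>\<^sub>0 complex)) set hspace"
  where "hilbert_tensor V W = completion (alg_tensor V W)"

definition alg_tensor_map ::
  "('v \<Rightarrow> 'v) \<Rightarrow> ('w \<Rightarrow> 'w) \<Rightarrow> ('v \<times> 'w \<Rightarrow>\<^sub>0 complex) \<Rightarrow> ('v \<times> 'w \<Rightarrow>\<^sub>0 complex)" where
  "alg_tensor_map S T a =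
     (\<Sum>p\<in>Poly_Mapping.keys a. Poly_Mapping.single (S (fst p), T (snd p)) (Poly_Mapping.lookup a p))"

lemma alg_tensor_map_elementary:
  "alg_tensor_map S T (Poly_Mapping.single (v, w) 1) = Poly_Mapping.single (S v, T w) 1"
  by (simp add: alg_tensor_map_def)

lemma ip_elementary:
  "ip (alg_tensor V W) (Poly_Mapping.single (v, w) 1) (Poly_Mapping.single (v', w') 1) =
   ip V v v' * ip W w w'"
  by (simp add: alg_tensor_def)

definition tensor_map :: "'v hspace \<Rightarrow> 'w hspace \<Rightarrow> ('v \<Rightarrow> 'v) \<Rightarrow> ('w \<Rightarrow> 'w) \<Rightarrow>
    (nat \<Rightarrow> ('v \<times> 'w \<Rightarrow>\<^sub>0 complex)) set \<Rightarrow> (nat \<Rightarrow> ('v \<times> 'w \<Rightarrow>\<^sub>0 complex)) set" where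
  "tensor_map V W S T = completion_map (alg_tensor V W) (alg_tensor_map S T)"


section \<open>Unitary representations\<close>

record ('g, 'v) rep =
  rspace :: "'v hspace"
  ract :: "'g \<Rightarrow> 'v \<Rightarrow> 'v"

definition unitary_rep :: "'g monoid \<Rightarrow> ('g, 'v) rep \<Rightarrow> bool" where
  "unitary_rep G \<pi> \<longleftrightarrow> group G \<and> hilbert_space (rspace \<pi>) \<and>
     (\<forall>g\<in>carrier G. unitary_map (rspace \<pi>) (rspace \<pi>) (ract \<pi> g)) \<and>
     (\<forall>g\<in>carrier G. \<forall>h\<in>carrier G. \<forall>v\<in>carrier (rspace \<pi>).
        ract \<pi> (g \<otimes>\<^bsub>G\<^esub> h) v = ract \<pi> g (ract \<pi> h v))"

definition unitarily_equivalent :: "'g monoid \<Rightarrow> ('g, 'v) rep \<Rightarrow> ('g, 'w) rep \<Rightarrow> bool" where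
  "unitarily_equivalent G \<pi> \<rho> \<longleftrightarrow>
     (\<exists>U. unitary_map (rspace \<pi>) (rspace \<rho>) U \<and>
        (\<forall>g\<in>carrier G. \<forall>v\<in>carrier (rspace \<pi>). U (ract \<pi> g v) = ract \<rho> g (U v)))"

definition irreducible_rep :: "'g monoid \<Rightarrow> ('g, 'v) rep \<Rightarrow> bool" where
  "irreducible_rep G \<pi> \<longleftrightarrow> unitary_rep G \<pi> \<and> carrier (rspace \<pi>) \<noteq> {vzero (rspace \<pi>)} \<and>
     (\<forall>W. closed_subspace (rspace \<pi>) W \<and> (\<forall>g\<in>carrier G. \<forall>v\<in>W. ract \<pi> g v \<in> W) \<longrightarrow>
        W = {vzero (rspace \<pi>)} \<or> W = carrier (rspace \<pi>))"

text \<open>\<open>(\<lambda>(g) f)(C) = f (g\<^sup>-\<^sup>1 C)\<close>, so that \<open>\<lambda>(g)\<close> maps the basis vector at \<open>C\<close> to the one at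
  \<open>g C\<close>; see \<open>quasi_regular_basis\<close>.\<close>

definition quasi_regular :: "'g monoid \<Rightarrow> 'g set \<Rightarrow> ('g, 'g set \<Rightarrow> complex) rep" where
  "quasi_regular G H = \<lparr>rspace = ell2 (lcosets\<^bsub>G\<^esub> H),
     ract = (\<lambda>g f C. if C \<in> lcosets\<^bsub>G\<^esub> H then f (inv\<^bsub>G\<^esub> g <#\<^bsub>G\<^esub> C) else 0)\<rparr>"

lemma quasi_regular_basis:
  fixes G (structure)
  assumes G: "group G" and H: "subgroup H G" and g: "g \<in> carrier G" and C: "C \<in> lcosets\<^bsub>G\<^esub> H"
  shows "ract (quasi_regular G H) g (\<lambda>D. if D = C then 1 else 0) =
         (\<lambda>D. if D = g <#\<^bsub>G\<^esub> C then 1 else 0)"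
proof -
  interpret group G by fact
  have HG: "H \<subseteq> carrier G" by (rule subgroup.subset[OF H])
  have sub: "D \<subseteq> carrier G" if "D \<in> lcosets\<^bsub>G\<^esub> H" for D
    using that HG by (auto simp: LCOSETS_def intro: subsetD[OF l_coset_subset_G])
  have move: "g <# C \<in> lcosets\<^bsub>G\<^esub> H"
  proof -
    obtain a where "a \<in> carrier G" "C = a <# H" using C by (auto simp: LCOSETS_def)
    then have "g <# C = (g \<otimes> a) <# H" "g \<otimes> a \<in> carrier G"
      using g HG by (auto simp: lcos_m_assoc)
    then show ?thesis by (auto simp: LCOSETS_def)
  qed
  have "(inv g <# D = C) = (D = g <# C)" if "D \<in> lcosets\<^bsub>G\<^esub> H" for D
  proof
    assume "inv g <# D = C"
    then have "g <# C = (g \<otimes> inv g) <# D" using g sub[OF that] by (auto simp: lcos_m_assoc)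
    then show "D = g <# C" using g sub[OF that] by (simp add: lcos_mult_one)
  next
    assume "D = g <# C"
    then have "inv g <# D = (inv g \<otimes> g) <# C" using g sub[OF C] by (simp add: lcos_m_assoc)
    then show "inv g <# D = C" using g sub[OF C] by (simp add: lcos_mult_one)
  qed
  then show ?thesis using move by (auto simp: quasi_regular_def fun_eq_iff)
qed

definition tensor_phi :: "nat \<Rightarrow> nat \<Rightarrow> (nat word, 'v) rep \<Rightarrow> (nat word, 'w) rep \<Rightarrow>
    (nat word, (nat \<Rightarrow> ('v \<times> 'w \<Rightarrow>\<^sub>0 complex)) set) rep" where
  "tensor_phi n m \<pi> \<rho> = \<lparr>rspace = hilbert_tensor (rspace \<pi>) (rspace \<rho>),
     ract = (\<lambda>g. tensor_map (rspace \<pi>) (rspace \<rho>)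
                  (ract \<pi> (fst (phi n m g))) (ract \<rho> (snd (phi n m g))))\<rparr>"

end

theory Submission
  imports Defs "HOL-Analysis.L2_Norm" "HOL-Algebra.Elementary_Groups"
begin

text \<open>
  The elements of \<open>\<phi>(F\<^bsub>nm\<^esub>)\<close> are pairs with equal exponent sums, and \<open>F\<^bsub>nm\<^esub>\<close> acts
  transitively on \<open>F\<^sub>n/H\<^sub>i \<times> F\<^sub>m/H\<^sub>j\<close>; the stabiliser of the base point is \<open>K\<^sub>l\<close> with
  \<open>l = m(i - 1) + j\<close>, which gives (i).

  If \<open>k > 0\<close> and \<open>x\<^sup>-\<^sup>1 g\<^sub>l\<^sup>k x \<in> K\<^sub>l\<^sub>'\<close>, then comparing exponents and using that the centraliser of a power
  of a free generator consists of the powers of that generator, one finds \<open>l = l'\<close> and \<open>x \<in> K\<^sub>l\<close>.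
  So every orbit of \<open>g\<^sub>l\<close> on \<open>F\<^bsub>nm\<^esub>/K\<^sub>l\<^sub>'\<close> is infinite, except that of the base point when \<open>l = l'\<close>.

  For (ii), the averages \<open>N\<^sup>-\<^sup>1 \<Sum>\<^bsub>k<N\<^esub> \<lambda>(g\<^sub>l\<^sup>k) f\<close> converge in norm to \<open>f(K\<^sub>l) \<delta>\<close>, where \<open>\<delta>\<close> is the basis
  vector at \<open>K\<^sub>l\<close>. Hence a nonzero closed invariant subspace contains \<open>\<delta>\<close>, which is cyclic.
  For (iii), a unitary intertwiner maps \<open>\<delta>\<close> to a unit vector fixed by \<open>g\<^sub>l\<close>, and there is none
  in \<open>\<ell>\<^sup>2(F\<^bsub>nm\<^esub>/K\<^sub>l\<^sub>')\<close> when \<open>l \<noteq> l'\<close>, because all orbits are infinite.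
\<close>

section \<open>The Hilbert space of square-summable functions\<close>

definition l2norm :: "'x set \<Rightarrow> ('x \<Rightarrow> complex) \<Rightarrow> real" where
  "l2norm X f = sqrt (\<Sum>\<^sub>\<infinity>x\<in>X. (cmod (f x))\<^sup>2)"

definition basis_vec :: "'x \<Rightarrow> 'x \<Rightarrow> complex" where
  "basis_vec x = (\<lambda>y. if y = x then 1 else 0)"

lemma ell2_iff:
  "f \<in> carrier (ell2 X) \<longleftrightarrow> (\<forall>x. x \<notin> X \<longrightarrow> f x = 0) \<and> (\<lambda>x. (cmod (f x))\<^sup>2) summable_on X"
  by (simp add: ell2_def)

lemma ell2_simps:
  "vadd (ell2 X) f g = (\<lambda>x. f x + g x)" "vzero (ell2 X) = (\<lambda>x. 0)"
  "vscale (ell2 X) c f = (\<lambda>x. c * f x)" "ip (ell2 X) f g = (\<Sum>\<^sub>\<infinity>x\<in>X. cnj (f x) * g x)"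
  by (simp_all add: ell2_def)

lemma ell2_outside: "f \<in> carrier (ell2 X) \<Longrightarrow> x \<notin> X \<Longrightarrow> f x = 0"
  by (simp add: ell2_iff)

lemma l2norm_nonneg [simp]: "0 \<le> l2norm X f"
  by (simp add: l2norm_def infsum_nonneg)

lemma l2norm_sq: "(l2norm X f)\<^sup>2 = (\<Sum>\<^sub>\<infinity>x\<in>X. (cmod (f x))\<^sup>2)"
  by (simp add: l2norm_def infsum_nonneg)

lemma ell2_ip_self: "ip (ell2 X) f f = of_real ((l2norm X f)\<^sup>2)"
proof -
  have *: "cnj (f x) * f x = of_real ((cmod (f x))\<^sup>2)" for x
    by (metis complex_norm_square mult.commute)
  show ?thesis
  proof (cases "(\<lambda>x. (cmod (f x))\<^sup>2) summable_on X")
    case True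
    then have "((\<lambda>x. complex_of_real ((cmod (f x))\<^sup>2)) has_sum of_real ((l2norm X f)\<^sup>2)) X"
      unfolding l2norm_sq by (intro has_sum_of_real has_sum_infsum)
    then show ?thesis unfolding ell2_simps * by (rule infsumI)
  next
    \<comment> \<open>Without summability both sums take the default value 0: the complex family
      cannot be summable either, since its real parts would be.\<close>
    case False
    then have "\<not> (\<lambda>x. complex_of_real ((cmod (f x))\<^sup>2)) summable_on X"
      using summable_on_Re by fastforce
    with False show ?thesis unfolding ell2_simps * l2norm_sq by (simp only: infsum_not_exists of_real_0 simp_thms)
  qed
qed

lemma ell2_vdist: "vdist (ell2 X) f g = l2norm X (\<lambda>x. f x - g x)"
proof -
  have "vadd (ell2 X) f (vscale (ell2 X) (-1) g) = (\<lambda>x. f x - g x)"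
    by (simp add: ell2_simps)
  then show ?thesis
    unfolding vdist_def Let_def by (simp only: ell2_ip_self Re_complex_of_real) simp
qed

lemma L2_set_le_l2norm:
  assumes "f \<in> carrier (ell2 X)" "F \<subseteq> X"
  shows "L2_set (\<lambda>x. cmod (f x)) F \<le> l2norm X f"
proof (cases "finite F")
  case True
  then show ?thesis
    unfolding L2_set_def l2norm_def using assms
    by (intro real_sqrt_le_mono finite_sum_le_infsum) (auto simp: ell2_iff)
qed simp

lemma cmod_le_l2norm:
  assumes "f \<in> carrier (ell2 X)"
  shows "cmod (f x) \<le> l2norm X f"
  using L2_set_le_l2norm[OF assms, of "{x}"] ell2_outside[OF assms] by (cases "x \<in> X") auto

text \<open>Bounded partial sums of nonnegative terms converge to at most the bound. This carries
  \<open>L2_set\<close> inequalities over finite sets to \<open>ell2 X\<close>; both the triangle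
  inequality and completeness are obtained through it.\<close>

lemma ell2_bounded:
  assumes supp: "\<And>x. x \<notin> X \<Longrightarrow> f x = 0"
    and bound: "\<And>F. finite F \<Longrightarrow> F \<subseteq> X \<Longrightarrow> L2_set (\<lambda>x. cmod (f x)) F \<le> B"
  shows "f \<in> carrier (ell2 X)" "l2norm X f \<le> B"
proof -
  have sq: "(\<Sum>x\<in>F. (cmod (f x))\<^sup>2) \<le> B\<^sup>2" if "finite F" "F \<subseteq> X" for F
    using bound[OF that] by (simp add: L2_set_def sqrt_le_D)
  have B: "0 \<le> B" using bound[of "{}"] by simp
  have summ: "(\<lambda>x. (cmod (f x))\<^sup>2) summable_on X"
    by (rule nonneg_bounded_partial_sums_imp_summable_on[where C = "B\<^sup>2"])
      (use sq in \<open>auto intro!: eventually_finite_subsets_at_top_weakI\<close>)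
  then show "f \<in> carrier (ell2 X)" using supp by (simp add: ell2_iff)
  have "(\<Sum>\<^sub>\<infinity>x\<in>X. (cmod (f x))\<^sup>2) \<le> B\<^sup>2"
    using summ sq by (rule infsum_le_finite_sums)
  with B show "l2norm X f \<le> B" unfolding l2norm_def by (intro real_le_lsqrt)
qed

lemma l2norm_add:
  assumes f: "f \<in> carrier (ell2 X)" and g: "g \<in> carrier (ell2 X)"
  shows "(\<lambda>x. f x + g x) \<in> carrier (ell2 X)" "l2norm X (\<lambda>x. f x + g x) \<le> l2norm X f + l2norm X g"
proof -
  have *: "L2_set (\<lambda>x. cmod (f x + g x)) F \<le> l2norm X f + l2norm X g" if "F \<subseteq> X" for F
  proof -
    have "L2_set (\<lambda>x. cmod (f x + g x)) F \<le> L2_set (\<lambda>x. cmod (f x) + cmod (g x)) F"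
      by (rule L2_set_mono) (auto intro: norm_triangle_ineq)
    also have "\<dots> \<le> L2_set (\<lambda>x. cmod (f x)) F + L2_set (\<lambda>x. cmod (g x)) F"
      by (rule L2_set_triangle_ineq)
    finally show ?thesis
      using L2_set_le_l2norm[OF f that] L2_set_le_l2norm[OF g that] by linarith
  qed
  have "f x + g x = 0" if "x \<notin> X" for x
    using that f g by (simp add: ell2_outside)
  then show "(\<lambda>x. f x + g x) \<in> carrier (ell2 X)" "l2norm X (\<lambda>x. f x + g x) \<le> l2norm X f + l2norm X g"
    using ell2_bounded[of X "\<lambda>x. f x + g x", OF _ *] by blast+
qed

lemma ell2_zero: "(\<lambda>x. 0) \<in> carrier (ell2 X)"
  by (simp add: ell2_iff)

lemma ell2_scale:
  "f \<in> carrier (ell2 X) \<Longrightarrow> (\<lambda>x. c * f x) \<in> carrier (ell2 X)"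
  by (auto simp: ell2_iff norm_mult power_mult_distrib intro!: summable_on_cmult_right)

lemma l2norm_scale: "l2norm X (\<lambda>x. c * f x) = cmod c * l2norm X f"
  by (simp add: l2norm_def norm_mult power_mult_distrib infsum_cmult_right' real_sqrt_mult)

lemma l2norm_minus: "l2norm X (\<lambda>x. f x - g x) = l2norm X (\<lambda>x. g x - f x)"
  by (simp add: l2norm_def norm_minus_commute)

lemma ell2_diff:
  assumes "f \<in> carrier (ell2 X)" "g \<in> carrier (ell2 X)"
  shows "(\<lambda>x. f x - g x) \<in> carrier (ell2 X)"
  using l2norm_add(1)[OF assms(1) ell2_scale[OF assms(2), of "-1"]] by simp

lemma l2norm_diff:
  assumes "f \<in> carrier (ell2 X)" "g \<in> carrier (ell2 X)"
  shows "l2norm X (\<lambda>x. f x - g x) \<le> l2norm X f + l2norm X g"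
  using l2norm_add(2)[OF assms(1) ell2_scale[OF assms(2), of "-1"]]
    l2norm_scale[of X "-1" g] by simp

lemma l2norm_triangle:
  assumes "f \<in> carrier (ell2 X)" "g \<in> carrier (ell2 X)" "h \<in> carrier (ell2 X)"
  shows "l2norm X (\<lambda>x. f x - h x) \<le> l2norm X (\<lambda>x. f x - g x) + l2norm X (\<lambda>x. g x - h x)"
  using l2norm_add(2)[OF ell2_diff[OF assms(1,2)] ell2_diff[OF assms(2,3)]] by simp

lemma ell2_sum:
  assumes "\<And>i. i \<in> I \<Longrightarrow> f i \<in> carrier (ell2 X)"
  shows "(\<lambda>x. \<Sum>i\<in>I. f i x) \<in> carrier (ell2 X)"
  using assms
  by (induction I rule: infinite_finite_induct) (auto simp: ell2_zero intro!: l2norm_add)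

lemma l2norm_zero [simp]: "l2norm X (\<lambda>x. 0) = 0"
  by (simp add: l2norm_def)

lemma l2norm_sum:
  assumes "\<And>i. i \<in> I \<Longrightarrow> f i \<in> carrier (ell2 X)"
  shows "l2norm X (\<lambda>x. \<Sum>i\<in>I. f i x) \<le> (\<Sum>i\<in>I. l2norm X (f i))"
  using assms
proof (induction I rule: infinite_finite_induct)
  case (insert i I)
  have "l2norm X (\<lambda>x. f i x + (\<Sum>i\<in>I. f i x)) \<le> l2norm X (f i) + l2norm X (\<lambda>x. \<Sum>i\<in>I. f i x)"
    using insert.prems by (intro l2norm_add ell2_sum) auto
  with insert show ?case by fastforce
qed auto

lemma l2norm_eq_0:
  assumes "f \<in> carrier (ell2 X)" "l2norm X f = 0"
  shows "f = (\<lambda>x. 0)"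
  using cmod_le_l2norm[OF assms(1)] assms(2) by auto

section \<open>The inner product of \<open>ell2\<close> and its continuity\<close>

lemma ell2_ip_summable:
  assumes "f \<in> carrier (ell2 X)" "g \<in> carrier (ell2 X)"
  shows "(\<lambda>x. cmod (cnj (f x) * g x)) summable_on X"
proof (rule summable_on_comparison_test)
  show "(\<lambda>x. (cmod (f x))\<^sup>2 + (cmod (g x))\<^sup>2) summable_on X"
    using assms by (auto simp: ell2_iff intro: summable_on_add)
  fix x
  have "2 * (cmod (f x) * cmod (g x)) \<le> (cmod (f x))\<^sup>2 + (cmod (g x))\<^sup>2"
    using sum_squares_bound[of "cmod (f x)" "cmod (g x)"] by simp
  moreover have "0 \<le> cmod (f x) * cmod (g x)" by simp
  ultimately show "cmod (cnj (f x) * g x) \<le> (cmod (f x))\<^sup>2 + (cmod (g x))\<^sup>2"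
    unfolding norm_mult complex_mod_cnj by linarith
qed auto

lemma ell2_ip_has_sum:
  assumes "f \<in> carrier (ell2 X)" "g \<in> carrier (ell2 X)"
  shows "((\<lambda>x. cnj (f x) * g x) has_sum ip (ell2 X) f g) X"
  unfolding ell2_simps
  using abs_summable_summable[OF ell2_ip_summable[OF assms]] by (rule has_sum_infsum)

lemma ell2_ip_add:
  assumes "f \<in> carrier (ell2 X)" "g \<in> carrier (ell2 X)" "h \<in> carrier (ell2 X)"
  shows "ip (ell2 X) f (\<lambda>x. g x + h x) = ip (ell2 X) f g + ip (ell2 X) f h"
  using has_sum_add[OF ell2_ip_has_sum[OF assms(1,2)] ell2_ip_has_sum[OF assms(1,3)]]
  by (auto intro!: infsumI simp: ell2_simps(4)[of X f "\<lambda>x. g x + h x"] distrib_left)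

lemma ell2_ip_scale: "ip (ell2 X) f (\<lambda>x. c * g x) = c * ip (ell2 X) f g"
  by (simp add: ell2_simps mult.left_commute infsum_cmult_right')

lemma ell2_ip_cnj: "ip (ell2 X) g f = cnj (ip (ell2 X) f g)"
  by (simp add: ell2_simps mult.commute flip: infsum_cnj)

lemma ell2_ip_sum_right:
  assumes "f \<in> carrier (ell2 X)" "\<And>i. i \<in> I \<Longrightarrow> g i \<in> carrier (ell2 X)"
  shows "ip (ell2 X) f (\<lambda>x. \<Sum>i\<in>I. c i * g i x) = (\<Sum>i\<in>I. c i * ip (ell2 X) f (g i))"
  using assms(2)
proof (induction I rule: infinite_finite_induct)
  case (insert i I)
  then show ?case
    using ell2_ip_add[OF assms(1), of "\<lambda>x. c i * g i x" "\<lambda>x. \<Sum>i\<in>I. c i * g i x"]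
    by (simp add: ell2_scale ell2_sum ell2_ip_scale)
qed (simp_all add: ell2_simps)

lemma ell2_ip_sum_left:
  assumes "f \<in> carrier (ell2 X)" "\<And>i. i \<in> I \<Longrightarrow> g i \<in> carrier (ell2 X)"
  shows "ip (ell2 X) (\<lambda>x. \<Sum>i\<in>I. c i * g i x) f = (\<Sum>i\<in>I. cnj (c i) * ip (ell2 X) (g i) f)"
proof -
  have "ip (ell2 X) (\<lambda>x. \<Sum>i\<in>I. c i * g i x) f = cnj (\<Sum>i\<in>I. c i * ip (ell2 X) f (g i))"
    using ell2_ip_cnj ell2_ip_sum_right[of f X I g c] assms by metis
  then show ?thesis by (simp add: ell2_ip_cnj[of X _ f])
qed

lemma ell2_Cauchy_Schwarz:
  assumes f: "f \<in> carrier (ell2 X)" and g: "g \<in> carrier (ell2 X)"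
  shows "cmod (ip (ell2 X) f g) \<le> l2norm X f * l2norm X g"
proof -
  have "cmod (ip (ell2 X) f g) \<le> (\<Sum>\<^sub>\<infinity>x\<in>X. cmod (cnj (f x) * g x))"
    unfolding ell2_simps by (rule norm_infsum_bound[OF ell2_ip_summable[OF assms]])
  also have "\<dots> \<le> l2norm X f * l2norm X g"
  proof (rule infsum_le_finite_sums[OF ell2_ip_summable[OF assms]])
    fix F assume F: "finite F" "F \<subseteq> X"
    have "(\<Sum>x\<in>F. cmod (cnj (f x) * g x)) \<le> L2_set (\<lambda>x. cmod (f x)) F * L2_set (\<lambda>x. cmod (g x)) F"
      using L2_set_mult_ineq[of "\<lambda>x. cmod (f x)" "\<lambda>x. cmod (g x)" F] by (simp add: norm_mult)
    also have "\<dots> \<le> l2norm X f * l2norm X g"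
      using L2_set_le_l2norm[OF f F(2)] L2_set_le_l2norm[OF g F(2)] by (intro mult_mono) auto
    finally show "(\<Sum>x\<in>F. cmod (cnj (f x) * g x)) \<le> l2norm X f * l2norm X g" .
  qed
  finally show ?thesis .
qed

lemma ell2_ip_tendsto:
  assumes f: "f \<in> carrier (ell2 X)" "\<And>n. s n \<in> carrier (ell2 X)"
      "(\<lambda>n. vdist (ell2 X) (s n) f) \<longlonglongrightarrow> 0"
    and g: "g \<in> carrier (ell2 X)" "\<And>n. t n \<in> carrier (ell2 X)"
      "(\<lambda>n. vdist (ell2 X) (t n) g) \<longlonglongrightarrow> 0"
  shows "(\<lambda>n. ip (ell2 X) (s n) (t n)) \<longlonglongrightarrow> ip (ell2 X) f g"
proof (rule LIM_zero_cancel, rule tendsto_0_le[where K = 1])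
  let ?d = "\<lambda>n. l2norm X (\<lambda>x. s n x - f x)" and ?e = "\<lambda>n. l2norm X (\<lambda>x. t n x - g x)"
  show "(\<lambda>n. (?d n + l2norm X f) * ?e n + ?d n * l2norm X g) \<longlonglongrightarrow> 0"
    using f(3) g(3) unfolding ell2_vdist by (auto intro!: tendsto_eq_intros)
  have "norm (ip (ell2 X) (s n) (t n) - ip (ell2 X) f g) \<le>
      (?d n + l2norm X f) * ?e n + ?d n * l2norm X g" for n
  proof -
    have d: "(\<lambda>x. s n x - f x) \<in> carrier (ell2 X)" and e: "(\<lambda>x. t n x - g x) \<in> carrier (ell2 X)"
      using f g by (auto intro: ell2_diff)
    \<comment> \<open>The difference of the inner products splits as
      \<open><s n, t n - g> + <s n - f, g>\<close>; Cauchy-Schwarz bounds each summand, and the norm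
      of \<open>s n\<close> is at most \<open>?d n\<close> plus the norm of
      \<open>f\<close>.\<close>
    have "ip (ell2 X) (s n) (t n) = ip (ell2 X) (s n) (\<lambda>x. t n x - g x) + ip (ell2 X) (s n) g"
      using ell2_ip_add[OF f(2)[of n] e g(1)] by simp
    moreover have "ip (ell2 X) (s n) g = ip (ell2 X) (\<lambda>x. s n x - f x) g + ip (ell2 X) f g"
      using ell2_ip_add[OF g(1) d f(1)] by (simp add: ell2_ip_cnj[of X _ g])
    ultimately have "norm (ip (ell2 X) (s n) (t n) - ip (ell2 X) f g) \<le>
        norm (ip (ell2 X) (s n) (\<lambda>x. t n x - g x)) + norm (ip (ell2 X) (\<lambda>x. s n x - f x) g)"
      by (simp add: norm_triangle_ineq)
    also have "\<dots> \<le> l2norm X (s n) * ?e n + ?d n * l2norm X g"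
      using ell2_Cauchy_Schwarz[OF f(2)[of n] e] ell2_Cauchy_Schwarz[OF d g(1)] by linarith
    also have "l2norm X (s n) \<le> ?d n + l2norm X f"
      using l2norm_add(2)[OF d f(1)] by simp
    finally show ?thesis by (simp add: mult_right_mono)
  qed
  then show "\<forall>\<^sub>F n in sequentially. norm (ip (ell2 X) (s n) (t n) - ip (ell2 X) f g) \<le>
      norm ((?d n + l2norm X f) * ?e n + ?d n * l2norm X g) * 1"
    by (intro always_eventually allI) (use abs_ge_self order_trans in fastforce)
qed

text \<open>Point values are bounded by the norm, so a Cauchy sequence converges pointwise. The
  limit is also a norm limit, because bounds on finite \<open>L2_set\<close> norms of
  \<open>s p - s q\<close> survive the passage to the limit in \<open>q\<close>.\<close>

lemma ell2_complete:
  assumes "cauchy_seq (ell2 X) s"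
  shows "\<exists>f\<in>carrier (ell2 X). (\<lambda>n. vdist (ell2 X) (s n) f) \<longlonglongrightarrow> 0"
proof -
  have s: "s n \<in> carrier (ell2 X)" for n using assms by (simp add: cauchy_seq_def)
  have cau: "\<exists>N. \<forall>p\<ge>N. \<forall>q\<ge>N. l2norm X (\<lambda>x. s p x - s q x) < e" if "e > 0" for e
    using assms that by (simp add: cauchy_seq_def ell2_vdist)
  have "Cauchy (\<lambda>n. s n x)" for x
  proof (rule metric_CauchyI)
    fix e :: real assume "e > 0"
    then obtain N where N: "\<forall>p\<ge>N. \<forall>q\<ge>N. l2norm X (\<lambda>x. s p x - s q x) < e" using cau by blast
    have "dist (s p x) (s q x) < e" if "p \<ge> N" "q \<ge> N" for p q
      using cmod_le_l2norm[OF ell2_diff[OF s[of p] s[of q]], of x] N that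
      by (auto simp: dist_norm intro: le_less_trans)
    then show "\<exists>M. \<forall>p\<ge>M. \<forall>q\<ge>M. dist (s p x) (s q x) < e" by blast
  qed
  then have "convergent (\<lambda>n. s n x)" for x by (rule Cauchy_convergent)
  then obtain f where f: "(\<lambda>n. s n x) \<longlonglongrightarrow> f x" for x
    unfolding convergent_def by metis
  have f0: "f x = 0" if "x \<notin> X" for x
    using f[of x] LIMSEQ_unique[OF f[of x], of 0] ell2_outside[OF s that] by simp
  have close: "(\<lambda>x. s p x - f x) \<in> carrier (ell2 X) \<and> l2norm X (\<lambda>x. s p x - f x) \<le> e"
    if N: "\<forall>p\<ge>N. \<forall>q\<ge>N. l2norm X (\<lambda>x. s p x - s q x) < e" and p: "p \<ge> N" for e N p
  proof -
    have "L2_set (\<lambda>x. cmod (s p x - f x)) F \<le> e" if F: "finite F" "F \<subseteq> X" for F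
    proof (rule LIMSEQ_le_const2)
      show "(\<lambda>q. L2_set (\<lambda>x. cmod (s p x - s q x)) F) \<longlonglongrightarrow> L2_set (\<lambda>x. cmod (s p x - f x)) F"
        unfolding L2_set_def by (intro tendsto_intros f)
      show "\<exists>M. \<forall>q\<ge>M. L2_set (\<lambda>x. cmod (s p x - s q x)) F \<le> e"
        using le_less_trans[OF L2_set_le_l2norm[OF ell2_diff[OF s[of p] s] F(2)]] N p
        by (intro exI[of _ N]) (auto intro: less_imp_le)
    qed
    then show ?thesis
      using ell2_bounded[of X "\<lambda>x. s p x - f x" e] f0 ell2_outside[OF s] by auto
  qed
  obtain N where N: "\<forall>p\<ge>N. \<forall>q\<ge>N. l2norm X (\<lambda>x. s p x - s q x) < 1" using cau[of 1] by auto
  \<comment> \<open>\<open>f\<close> is written as \<open>s N - (s N - f)\<close>, where both terms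
    lie in \<open>ell2 X\<close>.\<close>
  have "f \<in> carrier (ell2 X)"
    using ell2_diff[OF s[of N] conjunct1[OF close[OF N order_refl]]] by simp
  moreover have "(\<lambda>n. l2norm X (\<lambda>x. s n x - f x)) \<longlonglongrightarrow> 0"
  proof (rule LIMSEQ_I)
    fix r :: real assume "r > 0"
    then obtain N where "\<forall>p\<ge>N. \<forall>q\<ge>N. l2norm X (\<lambda>x. s p x - s q x) < r / 2"
      using cau[of "r/2"] by auto
    from close[OF this] \<open>r > 0\<close> show "\<exists>N. \<forall>n\<ge>N. norm (l2norm X (\<lambda>x. s n x - f x) - 0) < r"
      by fastforce
  qed
  ultimately show ?thesis unfolding ell2_vdist by blast
qed

lemma hilbert_space_ell2: "hilbert_space (ell2 X)"
proof (rule hilbert_space.intro)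
  show "comm_group \<lparr>carrier = carrier (ell2 X), monoid.mult = vadd (ell2 X), one = vzero (ell2 X)\<rparr>"
  proof (rule comm_groupI)
    fix f assume "f \<in> carrier \<lparr>carrier = carrier (ell2 X), monoid.mult = vadd (ell2 X), one = vzero (ell2 X)\<rparr>"
    then show "\<exists>g\<in>carrier \<lparr>carrier = carrier (ell2 X), monoid.mult = vadd (ell2 X), one = vzero (ell2 X)\<rparr>.
        g \<otimes>\<^bsub>\<lparr>carrier = carrier (ell2 X), monoid.mult = vadd (ell2 X), one = vzero (ell2 X)\<rparr>\<^esub> f =
        \<one>\<^bsub>\<lparr>carrier = carrier (ell2 X), monoid.mult = vadd (ell2 X), one = vzero (ell2 X)\<rparr>\<^esub>"
      using ell2_scale[of f X "- 1"] by (intro bexI[where x = "\<lambda>x. - f x"]) (auto simp: ell2_simps)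
  qed (auto simp: ell2_simps l2norm_add ell2_zero algebra_simps)
next
  fix f assume f: "f \<in> carrier (ell2 X)" "ip (ell2 X) f f = 0"
  then show "f = vzero (ell2 X)" by (simp add: ell2_ip_self l2norm_eq_0 ell2_simps)
next
  fix f g h assume "f \<in> carrier (ell2 X)" "g \<in> carrier (ell2 X)" "h \<in> carrier (ell2 X)"
  then show "ip (ell2 X) f (vadd (ell2 X) g h) = ip (ell2 X) f g + ip (ell2 X) f h"
    by (simp only: ell2_simps(1) ell2_ip_add)
next
  fix f g c assume "f \<in> carrier (ell2 X)" "g \<in> carrier (ell2 X)"
  show "ip (ell2 X) f (vscale (ell2 X) c g) = c * ip (ell2 X) f g"
    by (simp only: ell2_simps(3) ell2_ip_scale)
  show "ip (ell2 X) g f = cnj (ip (ell2 X) f g)" by (rule ell2_ip_cnj)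
next
  fix f show "0 \<le> Re (ip (ell2 X) f f)" by (simp add: ell2_ip_self)
qed (auto simp: ell2_simps(1-3) ell2_scale algebra_simps ell2_complete)

section \<open>Basis vectors and density of their span\<close>

lemma basis_vec_ell2: "x \<in> X \<Longrightarrow> basis_vec x \<in> carrier (ell2 X)"
  by (auto simp: ell2_iff basis_vec_def intro!: finite_nonzero_values_imp_summable_on
      intro: finite_subset[of _ "{x}"])

lemma l2norm_basis_vec: "x \<in> X \<Longrightarrow> l2norm X (basis_vec x) = 1"
proof -
  assume "x \<in> X"
  then have "(\<Sum>\<^sub>\<infinity>y\<in>X. (cmod (basis_vec x y))\<^sup>2) = (\<Sum>\<^sub>\<infinity>y\<in>{x}. (cmod (basis_vec x y))\<^sup>2)"
    by (intro infsum_cong_neutral) (auto simp: basis_vec_def)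
  then show ?thesis by (simp add: l2norm_def basis_vec_def)
qed

lemma ell2_finite_approx:
  assumes f: "f \<in> carrier (ell2 X)" and e: "e > 0"
  shows "\<exists>F. finite F \<and> F \<subseteq> X \<and> l2norm X (\<lambda>x. (\<Sum>y\<in>F. f y * basis_vec y x) - f x) < e"
proof -
  let ?q = "\<lambda>x. (cmod (f x))\<^sup>2"
  have summ: "?q summable_on X" using f by (simp add: ell2_iff)
  \<comment> \<open>The tolerance \<open>(e/2)\<^sup>2\<close> bounds the squared norm of the tail,
    so the norm is at most \<open>e/2\<close>, strictly below \<open>e\<close>.\<close>
  obtain F where F: "finite F" "F \<subseteq> X" and d: "dist (sum ?q F) (infsum ?q X) \<le> (e/2)\<^sup>2"
    using infsum_finite_approximation[OF summ, of "(e/2)\<^sup>2"] e by auto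
  have val: "(\<Sum>y\<in>F. f y * basis_vec y x) = (if x \<in> F then f x else 0)" for x
    using F by (simp add: basis_vec_def if_distrib cong: if_cong)
  have "infsum ?q X = infsum ?q F + infsum ?q (X - F)"
    using infsum_Un_disjoint[of ?q F "X - F"] F summ
    by (simp add: Un_absorb1 summable_on_subset)
  then have "infsum ?q (X - F) \<le> (e/2)\<^sup>2"
    using d F infsum_nonneg[of "X - F" ?q] by (simp add: dist_norm)
  moreover have "(\<Sum>\<^sub>\<infinity>x\<in>X. (cmod ((\<Sum>y\<in>F. f y * basis_vec y x) - f x))\<^sup>2) = infsum ?q (X - F)"
    unfolding val by (rule infsum_cong_neutral) auto
  ultimately have "l2norm X (\<lambda>x. (\<Sum>y\<in>F. f y * basis_vec y x) - f x) \<le> e / 2"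
    unfolding l2norm_def using e by (intro real_le_lsqrt) auto
  then show ?thesis using F e by (intro exI[of _ F]) auto
qed

text \<open>Finite truncations of \<open>f\<close> are linear combinations of basis vectors and so
  lie in \<open>D\<close>. The lemma is applied to the vectors on which a sequence of operators
  tends to 0, to a closed invariant subspace, and to the range of an isometry.\<close>

lemma ell2_dense:
  assumes add: "\<And>f g. f \<in> D \<Longrightarrow> g \<in> D \<Longrightarrow> (\<lambda>x. f x + g x) \<in> D"
    and scale: "\<And>c f. f \<in> D \<Longrightarrow> (\<lambda>x. c * f x) \<in> D"
    and zero: "(\<lambda>x. 0) \<in> D" and basis: "\<And>x. x \<in> X \<Longrightarrow> basis_vec x \<in> D"
    and f: "f \<in> carrier (ell2 X)"
  shows "\<exists>s. (\<forall>n. s n \<in> D) \<and> (\<lambda>n. vdist (ell2 X) (s n) f) \<longlonglongrightarrow> 0"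
proof -
  have "\<exists>g\<in>D. l2norm X (\<lambda>x. g x - f x) < inverse (real (Suc n))" for n
  proof -
    obtain F where F: "finite F" "F \<subseteq> X"
      and close: "l2norm X (\<lambda>x. (\<Sum>y\<in>F. f y * basis_vec y x) - f x) < inverse (real (Suc n))"
      using ell2_finite_approx[OF f, of "inverse (real (Suc n))"] by auto
    have "(\<lambda>x. \<Sum>y\<in>F. f y * basis_vec y x) \<in> D"
      using F by (induction F) (auto intro: zero scale basis intro!: add)
    then show ?thesis
      using close by (intro bexI[where x = "\<lambda>x. \<Sum>y\<in>F. f y * basis_vec y x"])
  qed
  then obtain s where s: "s n \<in> D" "l2norm X (\<lambda>x. s n x - f x) < inverse (real (Suc n))" for n
    by metis
  have "(\<lambda>n. l2norm X (\<lambda>x. s n x - f x)) \<longlonglongrightarrow> 0"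
    by (rule tendsto_sandwich[OF _ _ tendsto_const LIMSEQ_inverse_real_of_nat])
      (use s(2) in \<open>auto intro!: always_eventually less_imp_le\<close>)
  with s(1) show ?thesis unfolding ell2_vdist by blast
qed

section \<open>Quasi-regular representations\<close>

context
  fixes G :: "'g monoid" (structure) and H :: "'g set"
  assumes G: "group G" and H: "subgroup H G"
begin

interpretation group G by (rule G)

lemma lcoset_closed: "g \<in> carrier G \<Longrightarrow> g <# H \<in> lcosets H"
  by (auto simp: LCOSETS_def)

lemma lcosetE:
  assumes "C \<in> lcosets H"
  obtains x where "x \<in> carrier G" "C = x <# H"
  using assms by (auto simp: LCOSETS_def)

lemma l_coset_mult:
  assumes "g \<in> carrier G" "x \<in> carrier G"
  shows "g <# (x <# H) = (g \<otimes> x) <# H"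
  using assms subgroup.subset[OF H] by (simp add: lcos_m_assoc)

lemma lcoset_move: "g \<in> carrier G \<Longrightarrow> C \<in> lcosets H \<Longrightarrow> g <# C \<in> lcosets H"
  by (elim lcosetE) (simp add: l_coset_mult lcoset_closed)

lemma lcoset_assoc:
  "g \<in> carrier G \<Longrightarrow> h \<in> carrier G \<Longrightarrow> C \<in> lcosets H \<Longrightarrow> g <# (h <# C) = (g \<otimes> h) <# C"
  by (elim lcosetE) (simp add: l_coset_mult m_assoc)

lemma lcoset_one: "C \<in> lcosets H \<Longrightarrow> \<one> <# C = C"
  by (elim lcosetE) (simp add: l_coset_mult)

lemma lcoset_eq_iff:
  assumes "x \<in> carrier G" "y \<in> carrier G"
  shows "x <# H = y <# H \<longleftrightarrow> inv x \<otimes> y \<in> H"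
proof
  assume "x <# H = y <# H"
  then have "y \<in> x <# H" using lcos_self[OF assms(2) H] by simp
  then show "inv x \<otimes> y \<in> H" using subgroup.lcos_module_imp[OF H G assms(1)] by blast
next
  assume "inv x \<otimes> y \<in> H"
  then have "x \<otimes> (inv x \<otimes> y) \<in> x <# H" by (auto simp: l_coset_def)
  moreover have "x \<otimes> (inv x \<otimes> y) = y" using assms by (simp flip: m_assoc)
  ultimately show "x <# H = y <# H" using l_repr_independence[OF _ assms(1) H] by simp
qed

lemma lcoset_base: "H \<in> lcosets H"
proof -
  have "\<one> <# H = H" using subgroup.subset[OF H] by (rule lcos_mult_one)
  then show ?thesis using lcoset_closed[OF one_closed] by simp
qed

lemma lcoset_base_iff: "g \<in> carrier G \<Longrightarrow> g <# H = H \<longleftrightarrow> g \<in> H"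
  using lcoset_eq_iff[OF one_closed, of g] subgroup.subset[OF H] by (auto simp: lcos_mult_one)

lemma bij_lcoset_move:
  assumes g: "g \<in> carrier G"
  shows "bij_betw (\<lambda>C. g <# C) (lcosets H) (lcosets H)"
  by (rule bij_betwI[where g = "\<lambda>C. inv g <# C"])
    (use g in \<open>auto simp: lcoset_move lcoset_assoc lcoset_one\<close>)

lemma quasi_regular_apply:
  "ract (quasi_regular G H) g f C = (if C \<in> lcosets H then f (inv g <# C) else 0)"
  by (simp add: quasi_regular_def)

lemma quasi_regular_space: "rspace (quasi_regular G H) = ell2 (lcosets H)"
  by (simp add: quasi_regular_def)

text \<open>The operator composes \<open>f\<close> with a permutation of the cosets, so the sum of
  squares is only reindexed.\<close>

lemma quasi_regular_closed:
  assumes g: "g \<in> carrier G" and f: "f \<in> carrier (ell2 (lcosets H))"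
  shows "ract (quasi_regular G H) g f \<in> carrier (ell2 (lcosets H))"
    "l2norm (lcosets H) (ract (quasi_regular G H) g f) = l2norm (lcosets H) f"
proof -
  let ?q = "\<lambda>C. (cmod (f C))\<^sup>2"
  have bij: "bij_betw (\<lambda>C. inv g <# C) (lcosets H) (lcosets H)"
    using g by (intro bij_lcoset_move) simp
  have "(\<lambda>C. ?q (inv g <# C)) summable_on lcosets H"
    using f summable_on_reindex_bij_betw[OF bij, of ?q] by (simp add: ell2_iff)
  then show "ract (quasi_regular G H) g f \<in> carrier (ell2 (lcosets H))"
    by (simp add: ell2_iff quasi_regular_apply cong: summable_on_cong)
  show "l2norm (lcosets H) (ract (quasi_regular G H) g f) = l2norm (lcosets H) f"
    using infsum_reindex_bij_betw[OF bij, of ?q]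
    by (simp add: l2norm_def quasi_regular_apply cong: infsum_cong)
qed

lemma quasi_regular_mult:
  assumes "g \<in> carrier G" "h \<in> carrier G"
  shows "ract (quasi_regular G H) (g \<otimes> h) f =
    ract (quasi_regular G H) g (ract (quasi_regular G H) h f)"
  using assms
  by (auto simp: fun_eq_iff quasi_regular_apply lcoset_move lcoset_assoc inv_mult_group)

lemma quasi_regular_one:
  "f \<in> carrier (ell2 (lcosets H)) \<Longrightarrow> ract (quasi_regular G H) \<one> f = f"
  by (auto simp: fun_eq_iff quasi_regular_apply lcoset_one ell2_outside)

lemma quasi_regular_ip:
  assumes g: "g \<in> carrier G"
  shows "ip (ell2 (lcosets H)) (ract (quasi_regular G H) g e) (ract (quasi_regular G H) g f) =
    ip (ell2 (lcosets H)) e f"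
proof -
  have "bij_betw (\<lambda>C. inv g <# C) (lcosets H) (lcosets H)"
    using g by (intro bij_lcoset_move) simp
  from infsum_reindex_bij_betw[OF this, of "\<lambda>C. cnj (e C) * f C"] show ?thesis
    by (simp add: ell2_simps quasi_regular_apply cong: infsum_cong)
qed

lemma quasi_regular_unitary_map:
  assumes g: "g \<in> carrier G"
  shows "unitary_map (ell2 (lcosets H)) (ell2 (lcosets H)) (ract (quasi_regular G H) g)"
proof -
  have "bij_betw (ract (quasi_regular G H) g) (carrier (ell2 (lcosets H))) (carrier (ell2 (lcosets H)))"
    by (rule bij_betwI[where g = "ract (quasi_regular G H) (inv g)"])
      (use g in \<open>auto simp: quasi_regular_closed quasi_regular_one simp flip: quasi_regular_mult\<close>)
  then show ?thesis
    unfolding unitary_map_def using quasi_regular_ip[OF g]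
    by (auto simp: ell2_simps(1,3) quasi_regular_apply fun_eq_iff)
qed


end

lemma unitary_rep_quasi_regular:
  assumes "group G" "subgroup H G"
  shows "unitary_rep G (quasi_regular G H)"
  unfolding unitary_rep_def quasi_regular_space[OF assms]
  using assms hilbert_space_ell2 quasi_regular_unitary_map[OF assms] quasi_regular_mult[OF assms]
  by auto

lemma quasi_regular_basis_vec:
  assumes "group G" "subgroup H G" "g \<in> carrier G" "C \<in> lcosets\<^bsub>G\<^esub> H"
  shows "ract (quasi_regular G H) g (basis_vec C) = basis_vec (g <#\<^bsub>G\<^esub> C)"
  unfolding basis_vec_def by (rule quasi_regular_basis[OF assms])

section \<open>Averages along the powers of one group element\<close>

lemma l2norm_sum_basis_vec:
  assumes "finite F" "F \<subseteq> X"
  shows "l2norm X (\<lambda>x. \<Sum>y\<in>F. c * basis_vec y x) = cmod c * sqrt (card F)"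
proof -
  have val: "(\<Sum>y\<in>F. c * basis_vec y x) = (if x \<in> F then c else 0)" for x
    using assms by (simp add: basis_vec_def if_distrib cong: if_cong)
  have "(\<Sum>\<^sub>\<infinity>x\<in>X. (cmod (\<Sum>y\<in>F. c * basis_vec y x))\<^sup>2) = (\<Sum>\<^sub>\<infinity>x\<in>F. (cmod c)\<^sup>2)"
    unfolding val by (rule infsum_cong_neutral) (use assms in auto)
  then show ?thesis using assms by (simp add: l2norm_def real_sqrt_mult)
qed

text \<open>The vectors on which \<open>R n\<close> tends to 0 form a linear set, and the uniform
  bound \<open>B\<close> makes this set closed in norm. Since the span of the basis vectors is
  dense, testing on them suffices.\<close>

lemma ell2_operators_tendsto_zero:
  fixes R :: "nat \<Rightarrow> ('x \<Rightarrow> complex) \<Rightarrow> 'x \<Rightarrow> complex"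
  assumes add: "\<And>n f g. R n (\<lambda>x. f x + g x) = (\<lambda>x. R n f x + R n g x)"
    and scale: "\<And>n c f. R n (\<lambda>x. c * f x) = (\<lambda>x. c * R n f x)"
    and closed: "\<And>n f. f \<in> carrier (ell2 X) \<Longrightarrow> R n f \<in> carrier (ell2 X)"
    and bound: "\<And>n f. f \<in> carrier (ell2 X) \<Longrightarrow> l2norm X (R n f) \<le> B * l2norm X f"
    and basis: "\<And>x. x \<in> X \<Longrightarrow> (\<lambda>n. l2norm X (R n (basis_vec x))) \<longlonglongrightarrow> 0"
    and f: "f \<in> carrier (ell2 X)"
  shows "(\<lambda>n. l2norm X (R n f)) \<longlonglongrightarrow> 0"
proof -
  let ?D = "{f \<in> carrier (ell2 X). (\<lambda>n. l2norm X (R n f)) \<longlonglongrightarrow> 0}"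
  have "\<exists>s. (\<forall>n. s n \<in> ?D) \<and> (\<lambda>n. vdist (ell2 X) (s n) f) \<longlonglongrightarrow> 0"
  proof (rule ell2_dense[OF _ _ _ _ f])
    fix g h assume g: "g \<in> ?D" and h: "h \<in> ?D"
    have "(\<lambda>n. l2norm X (R n (\<lambda>x. g x + h x))) \<longlonglongrightarrow> 0"
    proof (rule tendsto_sandwich[OF _ _ tendsto_const])
      show "(\<lambda>n. l2norm X (R n g) + l2norm X (R n h)) \<longlonglongrightarrow> 0"
        using g h by (auto intro: tendsto_add_zero)
      show "\<forall>\<^sub>F n in sequentially. l2norm X (R n (\<lambda>x. g x + h x)) \<le> l2norm X (R n g) + l2norm X (R n h)"
        using g h by (auto simp: add intro!: always_eventually l2norm_add closed)
    qed auto
    then show "(\<lambda>x. g x + h x) \<in> ?D" using g h by (auto intro: l2norm_add)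
  next
    fix c g assume "g \<in> ?D"
    then show "(\<lambda>x. c * g x) \<in> ?D"
      by (auto simp: scale l2norm_scale intro: ell2_scale tendsto_mult_right_zero)
  next
    have "R n (\<lambda>x. 0) = (\<lambda>x. 0)" for n using scale[of n 0 "\<lambda>x. 0"] by simp
    then show "(\<lambda>x. 0) \<in> ?D" by (simp add: ell2_zero)
  qed (simp add: basis basis_vec_ell2)
  then obtain s where s: "\<And>k. s k \<in> carrier (ell2 X)"
    and R0: "\<And>k. (\<lambda>n. l2norm X (R n (s k))) \<longlonglongrightarrow> 0"
    and lim: "(\<lambda>k. l2norm X (\<lambda>x. s k x - f x)) \<longlonglongrightarrow> 0"
    unfolding ell2_vdist by blast
  show ?thesis
  proof (rule LIMSEQ_I)
    fix r :: real assume r: "r > 0"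
    \<comment> \<open>An \<open>r/2\<close> argument: \<open>f\<close> is replaced by some
      \<open>s k\<close>, whose error costs at most \<open>\<bar>B\<bar>\<close> times the distance
      uniformly in \<open>n\<close>, and then \<open>n\<close> is taken large for this fixed
      \<open>k\<close>. The absolute value is there because the sign of \<open>B\<close> is not
      prescribed.\<close>
    have "(\<lambda>k. \<bar>B\<bar> * l2norm X (\<lambda>x. s k x - f x)) \<longlonglongrightarrow> 0" using lim by (rule tendsto_mult_right_zero)
    then obtain k where k: "\<bar>B\<bar> * l2norm X (\<lambda>x. s k x - f x) < r / 2"
      using r LIMSEQ_D[of _ 0 "r/2"] by fastforce
    obtain N where N: "\<And>n. n \<ge> N \<Longrightarrow> l2norm X (R n (s k)) < r / 2"
      using r LIMSEQ_D[OF R0[of k], of "r/2"] by fastforce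
    have "l2norm X (R n f) < r" if "n \<ge> N" for n
    proof -
      let ?h = "\<lambda>x. f x - s k x"
      have h: "?h \<in> carrier (ell2 X)" using f s by (rule ell2_diff)
      have "l2norm X (R n f) = l2norm X (\<lambda>x. R n ?h x + R n (s k) x)"
        using add[of n ?h "s k"] by simp
      also have "\<dots> \<le> l2norm X (R n ?h) + l2norm X (R n (s k))"
        by (intro l2norm_add closed h s)
      also have "l2norm X (R n ?h) \<le> B * l2norm X ?h" by (rule bound[OF h])
      also have "\<dots> \<le> \<bar>B\<bar> * l2norm X ?h" by (simp add: mult_right_mono)
      also have "\<dots> = \<bar>B\<bar> * l2norm X (\<lambda>x. s k x - f x)" by (simp only: l2norm_minus[of X f])
      finally show ?thesis using k N[OF that] by linarith
    qed
    then show "\<exists>N. \<forall>n\<ge>N. norm (l2norm X (R n f) - 0) < r" by auto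
  qed
qed

text \<open>If the cosets for exponents \<open>k < l\<close> agreed, cancelling
  \<open>z [^] k\<close> would put the conjugate of \<open>z [^] (l - k)\<close> by \<open>x\<close>
  into \<open>H\<close>, with positive exponent \<open>l - k\<close>.\<close>

lemma orbit_inj:
  fixes G :: "'g monoid" (structure)
  assumes G: "group G" and H: "subgroup H G" and x: "x \<in> carrier G" and z: "z \<in> carrier G"
    and free: "\<And>k::nat. k > 0 \<Longrightarrow> inv x \<otimes> (z [^] k \<otimes> x) \<notin> H"
  shows "inj (\<lambda>k::nat. z [^] k <# (x <# H))"
proof (rule linorder_injI)
  interpret group G by (rule G)
  fix k l :: nat assume kl: "k < l"
  have "z [^] l = z [^] k \<otimes> z [^] (l - k)" using z kl by (simp add: nat_pow_mult)
  then have "inv (z [^] k \<otimes> x) \<otimes> (z [^] l \<otimes> x) =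
      inv x \<otimes> ((inv (z [^] k) \<otimes> z [^] k) \<otimes> (z [^] (l - k) \<otimes> x))"
    using x z by (simp only: inv_mult_group m_assoc nat_pow_closed inv_closed m_closed)
  then have "inv (z [^] k \<otimes> x) \<otimes> (z [^] l \<otimes> x) = inv x \<otimes> (z [^] (l - k) \<otimes> x)"
    using x z by simp
  then show "z [^] k <# (x <# H) \<noteq> z [^] l <# (x <# H)"
    using free[of "l - k"] kl x z by (simp add: l_coset_mult[OF G H] lcoset_eq_iff[OF G H])
qed

text \<open>A mean ergodic theorem for \<open>z\<close>. By \<open>sep\<close> every coset other
  than \<open>H\<close> has an injective orbit under the powers of \<open>z\<close>, so averaging
  spreads its basis vector over \<open>n + 1\<close> distinct cosets and leaves norm
  \<open>1 / sqrt (n + 1)\<close>, while the basis vector at \<open>H\<close> is fixed.\<close>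

lemma quasi_regular_mean:
  fixes G :: "'g monoid" (structure)
  assumes G: "group G" and H: "subgroup H G" and z: "z \<in> H"
    and sep: "\<And>x k. x \<in> carrier G \<Longrightarrow> k > (0::nat) \<Longrightarrow> inv x \<otimes> (z [^] k \<otimes> x) \<in> H \<Longrightarrow> x \<in> H"
    and f: "f \<in> carrier (ell2 (lcosets H))"
  shows "(\<lambda>n. vdist (ell2 (lcosets H))
      (\<lambda>C. \<Sum>k<Suc n. inverse (of_nat (Suc n)) * ract (quasi_regular G H) (z [^] k) f C)
      (\<lambda>C. f H * basis_vec H C)) \<longlonglongrightarrow> 0"
proof -
  interpret group G by (rule G)
  define Z where "Z = lcosets H"
  \<comment> \<open>Averaging over \<open>Suc n\<close> powers keeps the divisor nonzero also for
    \<open>n = 0\<close>.\<close>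
  define c where "c n = inverse (complex_of_nat (Suc n))" for n
  define A where "A n f C = (\<Sum>k<Suc n. c n * ract (quasi_regular G H) (z [^] k) f C)" for n f C
  define R where "R n f C = A n f C - f H * basis_vec H C" for n f C
  note closed = quasi_regular_closed[OF G H, folded Z_def]
  have zG: "z \<in> carrier G" using subgroup.mem_carrier[OF H z] .
  have zk: "z [^] k \<in> carrier G" for k :: nat using zG by simp
  have HZ: "H \<in> Z" unfolding Z_def by (rule lcoset_base[OF G H])
  have A_closed: "A n f \<in> carrier (ell2 Z)" if "f \<in> carrier (ell2 Z)" for n f
    unfolding A_def using closed(1)[OF zk that] by (intro ell2_sum ell2_scale)
  have A_bound: "l2norm Z (A n f) \<le> l2norm Z f" if f: "f \<in> carrier (ell2 Z)" for n f
  proof -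
    have "l2norm Z (A n f) \<le> (\<Sum>k<Suc n. l2norm Z (\<lambda>C. c n * ract (quasi_regular G H) (z [^] k) f C))"
      unfolding A_def using closed(1)[OF zk f] by (intro l2norm_sum ell2_scale)
    also have "\<dots> = (\<Sum>k<Suc n. cmod (c n) * l2norm Z f)"
      using closed(2)[OF zk f] by (simp only: l2norm_scale)
    also have "\<dots> = l2norm Z f"
      by (simp add: c_def norm_inverse flip: of_nat_Suc)
    finally show ?thesis .
  qed
  have base: "(\<lambda>C. f H * basis_vec H C) \<in> carrier (ell2 Z)" for f :: "'g set \<Rightarrow> complex"
    using HZ by (intro ell2_scale basis_vec_ell2)
  have "(\<lambda>n. l2norm Z (R n f)) \<longlonglongrightarrow> 0"
  \<comment> \<open>The bound 2 is 1 for the average, a mean of isometries, plus 1 for the limit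
    term, since \<open>cmod (f H)\<close> is at most the norm of \<open>f\<close>.\<close>
  proof (rule ell2_operators_tendsto_zero[where B = 2])
    show "R n (\<lambda>x. f x + g x) = (\<lambda>x. R n f x + R n g x)" for n f g
      by (auto simp: R_def A_def fun_eq_iff quasi_regular_apply[OF G H] algebra_simps sum.distrib)
    show "R n (\<lambda>x. d * f x) = (\<lambda>x. d * R n f x)" for n d f
      by (auto simp: R_def A_def fun_eq_iff quasi_regular_apply[OF G H] algebra_simps sum_distrib_left)
    show "f \<in> carrier (ell2 Z)" using f by (simp add: Z_def)
    fix n f assume f: "f \<in> carrier (ell2 Z)"
    show "R n f \<in> carrier (ell2 Z)"
      unfolding R_def by (intro ell2_diff A_closed f base)
    have "l2norm Z (R n f) \<le> l2norm Z (A n f) + l2norm Z (\<lambda>C. f H * basis_vec H C)"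
      unfolding R_def by (intro l2norm_diff A_closed f base)
    also have "l2norm Z (\<lambda>C. f H * basis_vec H C) \<le> l2norm Z f"
      using cmod_le_l2norm[OF f, of H] HZ by (simp add: l2norm_scale l2norm_basis_vec)
    finally show "l2norm Z (R n f) \<le> 2 * l2norm Z f" using A_bound[OF f, of n] by simp
  next
    fix C assume C: "C \<in> Z"
    have Ab: "A n (basis_vec C) = (\<lambda>D. \<Sum>k<Suc n. c n * basis_vec (z [^] k <# C) D)" for n
      using C zk unfolding A_def Z_def by (simp add: quasi_regular_basis_vec[OF G H])
    show "(\<lambda>n. l2norm Z (R n (basis_vec C))) \<longlonglongrightarrow> 0"
    proof (cases "C = H")
      case True
      have "z [^] k \<in> H" for k :: nat
        by (induction k) (simp_all add: z subgroup.one_closed[OF H] subgroup.m_closed[OF H])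
      then have "z [^] k <# H = H" for k :: nat
        using zk by (simp add: lcoset_base_iff[OF G H])
      then have "A n (basis_vec C) = basis_vec C" for n
        unfolding Ab using True by (simp add: c_def field_simps del: of_nat_Suc sum.lessThan_Suc)
      then have "R n (basis_vec C) = (\<lambda>D. 0)" for n
        by (simp add: R_def True fun_eq_iff basis_vec_def)
      then show ?thesis by simp
    next
      case False
      obtain x where x: "x \<in> carrier G" "C = x <# H" using C unfolding Z_def by (rule lcosetE[OF G H])
      have "x \<notin> H" using False x by (simp add: lcoset_base_iff[OF G H])
      then have inj: "inj (\<lambda>k::nat. z [^] k <# C)"
        unfolding x(2) using sep x by (intro orbit_inj[OF G H x(1) zG]) blast
      have "l2norm Z (R n (basis_vec C)) = inverse (sqrt (real (Suc n)))" for n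
      proof -
        \<comment> \<open>For \<open>C \<noteq> H\<close> the limit term vanishes, as
          \<open>basis_vec C\<close> is 0 at \<open>H\<close>; injectivity turns the sum over
          exponents into one over \<open>Suc n\<close> distinct cosets.\<close>
        have "R n (basis_vec C) = (\<lambda>D. \<Sum>E\<in>(\<lambda>k. z [^] k <# C) ` {..<Suc n}. c n * basis_vec E D)"
          unfolding R_def Ab using False
          by (simp add: fun_eq_iff basis_vec_def[of C] sum.reindex[OF inj_on_subset[OF inj]])
        moreover have "(\<lambda>k. z [^] k <# C) ` {..<Suc n} \<subseteq> Z"
          using C zk by (auto simp: Z_def intro: lcoset_move[OF G H])
        ultimately have "l2norm Z (R n (basis_vec C)) = cmod (c n) * sqrt (Suc n)"
          using card_image[OF inj_on_subset[OF inj subset_UNIV], of "{..<Suc n}"]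
          by (simp add: l2norm_sum_basis_vec)
        also have "\<dots> = inverse (sqrt (real (Suc n)))"
          by (simp add: c_def norm_inverse real_div_sqrt divide_inverse[symmetric] del: of_nat_Suc)
            (simp add: field_simps del: of_nat_Suc)
        finally show ?thesis .
      qed
      moreover have "(\<lambda>n. inverse (sqrt (real (Suc n)))) \<longlonglongrightarrow> 0"
        using tendsto_real_sqrt[OF LIMSEQ_inverse_real_of_nat] by (simp add: real_sqrt_inverse)
      ultimately show ?thesis by simp
    qed
  qed
  then show ?thesis unfolding ell2_vdist Z_def R_def A_def c_def .
qed

text \<open>Up to a scalar, the averages isolate the component at \<open>H\<close> of any vector.
  Later \<open>z\<close> is the generator with index \<open>l\<close> and \<open>H\<close> is
  \<open>Ksub n m l\<close>, and \<open>sep\<close> comes from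
  \<open>conj_gen_pow_in_Ksub\<close>.\<close>

lemma irreducible_quasi_regular:
  fixes G :: "'g monoid" (structure)
  assumes G: "group G" and H: "subgroup H G" and z: "z \<in> H"
    and sep: "\<And>x k. x \<in> carrier G \<Longrightarrow> k > (0::nat) \<Longrightarrow> inv x \<otimes> (z [^] k \<otimes> x) \<in> H \<Longrightarrow> x \<in> H"
  shows "irreducible_rep G (quasi_regular G H)"
proof -
  interpret group G by (rule G)
  let ?Z = "lcosets H" and ?\<pi> = "ract (quasi_regular G H)"
  have zk: "z [^] k \<in> carrier G" for k :: nat using subgroup.mem_carrier[OF H z] by simp
  have HZ: "H \<in> ?Z" by (rule lcoset_base[OF G H])
  have "W = carrier (ell2 ?Z)"
    if W: "closed_subspace (ell2 ?Z) W" and inv: "\<And>g f. g \<in> carrier G \<Longrightarrow> f \<in> W \<Longrightarrow> ?\<pi> g f \<in> W"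
      and nz: "W \<noteq> {\<lambda>C. 0}" for W
  proof -
    have WE: "f \<in> carrier (ell2 ?Z)" if "f \<in> W" for f using W that by (auto simp: closed_subspace_def)
    have W0: "(\<lambda>C. 0) \<in> W" and Wadd: "\<And>f g. f \<in> W \<Longrightarrow> g \<in> W \<Longrightarrow> (\<lambda>C. f C + g C) \<in> W"
      and Wscale: "\<And>c f. f \<in> W \<Longrightarrow> (\<lambda>C. c * f C) \<in> W"
      using W by (simp_all add: closed_subspace_def ell2_simps)
    have Wlim: "f \<in> W" if "\<And>n. s n \<in> W" "f \<in> carrier (ell2 ?Z)"
        "(\<lambda>n. vdist (ell2 ?Z) (s n) f) \<longlonglongrightarrow> 0" for s f
      using W that unfolding closed_subspace_def by blast
    obtain f where f: "f \<in> W" "f \<noteq> (\<lambda>C. 0)" using W0 nz by blast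
    then obtain C where C: "f C \<noteq> 0" by auto
    then have "C \<in> ?Z" using ell2_outside[OF WE[OF f(1)]] by blast
    then obtain x where x: "x \<in> carrier G" "C = x <# H" by (rule lcosetE[OF G H])
    \<comment> \<open>Translation by \<open>inv x\<close> moves the nonzero value of
      \<open>f\<close> from \<open>C\<close> to the base coset \<open>H\<close>.\<close>
    define h where "h = ?\<pi> (inv x) f"
    have h: "h \<in> W" unfolding h_def using x f by (intro inv) auto
    have hH: "h H \<noteq> 0" using C x HZ by (simp add: h_def quasi_regular_apply[OF G H])
    have Wsum: "(\<lambda>C. \<Sum>k<N. c * ?\<pi> (z [^] k) h C) \<in> W" for c and N :: nat
      by (induction N) (auto intro!: W0 Wadd Wscale inv zk h)
    \<comment> \<open>The averages of \<open>h\<close> stay in \<open>W\<close> and converge to this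
      vector, so closedness of \<open>W\<close> applies.\<close>
    have "(\<lambda>C. h H * basis_vec H C) \<in> W"
      by (rule Wlim[OF Wsum _ quasi_regular_mean[OF G H z sep WE[OF h]]])
        (use HZ in \<open>auto intro: ell2_scale basis_vec_ell2\<close>)
    from Wscale[OF this, of "inverse (h H)"] have base: "basis_vec H \<in> W"
      using hH by (simp flip: mult.assoc)
    have "basis_vec D \<in> W" if "D \<in> ?Z" for D
    proof -
      obtain y where y: "y \<in> carrier G" "D = y <# H"
        using lcosetE[OF G H \<open>D \<in> ?Z\<close>] by blast
      then show ?thesis using inv[OF y(1) base] quasi_regular_basis_vec[OF G H y(1) HZ] by simp
    qed
    then have "e \<in> W" if "e \<in> carrier (ell2 ?Z)" for e
      using ell2_dense[OF Wadd Wscale W0 _ that] Wlim that by metis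
    with WE show ?thesis by blast
  qed
  moreover have "basis_vec H \<noteq> (\<lambda>C. 0)" by (auto simp: basis_vec_def fun_eq_iff)
  then have "carrier (ell2 ?Z) \<noteq> {\<lambda>C. 0}" using basis_vec_ell2[OF HZ] by blast
  ultimately show ?thesis
    unfolding irreducible_rep_def quasi_regular_space[OF G H] ell2_simps(2)
    using unitary_rep_quasi_regular[OF G H] by blast
qed

text \<open>An intertwiner sends the \<open>z\<close>-fixed unit vector \<open>basis_vec H\<close>
  to a \<open>z\<close>-fixed unit vector \<open>v\<close>, which is constant on
  \<open>z\<close>-orbits of cosets of \<open>H'\<close>. By \<open>sep\<close> these orbits are
  infinite, so square-summability forces \<open>v\<close> to vanish.\<close>

lemma quasi_regular_not_equivalent:
  fixes G :: "'g monoid" (structure)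
  assumes G: "group G" and H: "subgroup H G" and H': "subgroup H' G" and z: "z \<in> H"
    and sep: "\<And>x k. x \<in> carrier G \<Longrightarrow> k > (0::nat) \<Longrightarrow> inv x \<otimes> (z [^] k \<otimes> x) \<notin> H'"
  shows "\<not> unitarily_equivalent G (quasi_regular G H) (quasi_regular G H')"
proof
  interpret group G by (rule G)
  assume "unitarily_equivalent G (quasi_regular G H) (quasi_regular G H')"
  then obtain U where U: "unitary_map (ell2 (lcosets H)) (ell2 (lcosets H')) U"
    and inter: "\<And>g f. g \<in> carrier G \<Longrightarrow> f \<in> carrier (ell2 (lcosets H)) \<Longrightarrow>
      U (ract (quasi_regular G H) g f) = ract (quasi_regular G H') g (U f)"
    unfolding unitarily_equivalent_def quasi_regular_space[OF G H] quasi_regular_space[OF G H'] by blast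
  have zG: "z \<in> carrier G" using subgroup.mem_carrier[OF H z] .
  have HZ: "H \<in> lcosets H" by (rule lcoset_base[OF G H])
  define v where "v = U (basis_vec H)"
  have v: "v \<in> carrier (ell2 (lcosets H'))"
    using U basis_vec_ell2[OF HZ] by (auto simp: v_def unitary_map_def bij_betw_def)
  have "ip (ell2 (lcosets H')) v v = ip (ell2 (lcosets H)) (basis_vec H) (basis_vec H)"
    using U basis_vec_ell2[OF HZ] by (simp add: v_def unitary_map_def)
  then have "of_real ((l2norm (lcosets H') v)\<^sup>2) = (1::complex)"
    unfolding ell2_ip_self l2norm_basis_vec[OF HZ] by simp
  then have v1: "l2norm (lcosets H') v = 1"
    by (metis l2norm_nonneg of_real_eq_1_iff abs_of_nonneg power2_eq_1_iff abs_1 abs_minus_cancel)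
  have "z <# H = H" using z zG by (simp add: lcoset_base_iff[OF G H])
  then have fixed: "ract (quasi_regular G H') z v = v"
    unfolding v_def using inter[OF zG basis_vec_ell2[OF HZ]]
    by (simp add: quasi_regular_basis_vec[OF G H zG HZ])
  have step: "v (z <# C) = v C" if C: "C \<in> lcosets H'" for C
  proof -
    have "v (z <# C) = v (inv z <# (z <# C))"
      using fun_cong[OF fixed, of "z <# C"] lcoset_move[OF G H' zG C]
      by (simp add: quasi_regular_apply[OF G H'])
    then show ?thesis using zG C by (simp add: lcoset_assoc[OF G H'] lcoset_one[OF G H'])
  qed
  have orbit: "v (z [^] k <# C) = v C" if C: "C \<in> lcosets H'" for C and k :: nat
  proof (induction k)
    case (Suc k)
    have "z [^] Suc k <# C = z <# (z [^] k <# C)"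
      using zG C by (simp only: nat_pow_Suc2 lcoset_assoc[OF G H'] nat_pow_closed)
    then show ?case using Suc step lcoset_move[OF G H' nat_pow_closed[OF zG] C] by simp
  qed (use C in \<open>simp add: lcoset_one[OF G H']\<close>)
  have "v C = 0" for C
  proof (cases "C \<in> lcosets H'")
    case True
    then obtain x where x: "x \<in> carrier G" "C = x <# H'" by (rule lcosetE[OF G H'])
    have inj: "inj (\<lambda>k::nat. z [^] k <# C)"
      unfolding x(2) using sep x by (intro orbit_inj[OF G H' x(1) zG]) blast
    \<comment> \<open>The first \<open>N\<close> points of the orbit of \<open>C\<close> are
      distinct and carry the same value of \<open>v\<close>; their joint contribution is at most the
      norm of \<open>v\<close>, which is 1.\<close>
    have le: "sqrt (real N) * cmod (v C) \<le> 1" for N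
    proof -
      let ?F = "(\<lambda>k::nat. z [^] k <# C) ` {..<N}"
      have "?F \<subseteq> lcosets H'" using lcoset_move[OF G H' nat_pow_closed[OF zG] True] by blast
      then have "L2_set (\<lambda>D. cmod (v D)) ?F \<le> 1" using L2_set_le_l2norm[OF v] v1 by metis
      moreover have "L2_set (\<lambda>D. cmod (v D)) ?F = L2_set (\<lambda>D. cmod (v C)) ?F"
        using orbit[OF True] by (intro L2_set_cong) auto
      moreover have "card ?F = N" using card_image[OF inj_on_subset[OF inj subset_UNIV], of "{..<N}"] by simp
      ultimately show ?thesis by (simp add: L2_set_constant)
    qed
    show ?thesis
    proof (rule ccontr)
      assume "v C \<noteq> 0"
      obtain N :: nat where N: "real N > (1 / cmod (v C))\<^sup>2" using reals_Archimedean2 by blast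
      then have "sqrt (real N) > 1 / cmod (v C)" by (simp add: real_less_rsqrt)
      then have "sqrt (real N) * cmod (v C) > 1" using \<open>v C \<noteq> 0\<close> by (simp add: field_simps)
      with le[of N] show False by simp
    qed
  qed (rule ell2_outside[OF v])
  then have "v = (\<lambda>C. 0)" by auto
  with v1 show False by simp
qed

section \<open>Completions and tensor products\<close>

text \<open>The construction below yields a unitary into the tensor product, whereas the equivalence
  to be proved runs out of it. Closure of \<open>V\<close> under its operations lets sums and
  multiples of preimages serve as preimages.\<close>

lemma unitary_map_inv_into:
  assumes U: "unitary_map V W U" and add: "\<And>v w. v \<in> carrier V \<Longrightarrow> w \<in> carrier V \<Longrightarrow> vadd V v w \<in> carrier V"
    and scale: "\<And>c v. v \<in> carrier V \<Longrightarrow> vscale V c v \<in> carrier V"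
  shows "unitary_map W V (inv_into (carrier V) U)"
proof -
  have bij: "bij_betw U (carrier V) (carrier W)" using U by (simp add: unitary_map_def)
  have img: "U ` carrier V = carrier W" and inj: "inj_on U (carrier V)"
    using bij by (auto simp: bij_betw_def)
  show ?thesis
    unfolding unitary_map_def
  proof (intro conjI ballI allI)
    show "bij_betw (inv_into (carrier V) U) (carrier W) (carrier V)"
      using bij by (rule bij_betw_inv_into)
  next
    fix w w' assume "w \<in> carrier W" "w' \<in> carrier W"
    then obtain v v' where v: "v \<in> carrier V" "w = U v" "v' \<in> carrier V" "w' = U v'" using img by blast
    then show "inv_into (carrier V) U (vadd W w w') =
        vadd V (inv_into (carrier V) U w) (inv_into (carrier V) U w')"
      "ip V (inv_into (carrier V) U w) (inv_into (carrier V) U w') = ip W w w'"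
      using U inv_into_f_eq[OF inj add[OF v(1,3)]] inj by (auto simp: unitary_map_def)
  next
    fix c w assume "w \<in> carrier W"
    then obtain v where v: "v \<in> carrier V" "w = U v" using img by blast
    then show "inv_into (carrier V) U (vscale W c w) = vscale V c (inv_into (carrier V) U w)"
      using U inv_into_f_eq[OF inj scale[OF v(1)]] inj by (auto simp: unitary_map_def)
  qed
qed

text \<open>For an isometry \<open>T\<close> of \<open>V\<close> into \<open>\<ell>\<^sup>2(X)\<close> with dense range, this is the element of the
  completion of \<open>V\<close> that corresponds to \<open>e\<close>.\<close>

definition approx_seqs :: "'v hspace \<Rightarrow> 'x set \<Rightarrow> ('v \<Rightarrow> 'x \<Rightarrow> complex) \<Rightarrow> ('x \<Rightarrow> complex) \<Rightarrow> (nat \<Rightarrow> 'v) set"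
  where "approx_seqs V X T e =
    {s. (\<forall>n. s n \<in> carrier V) \<and> (\<lambda>n. vdist (ell2 X) (T (s n)) e) \<longlonglongrightarrow> 0}"

section \<open>The completion of a space with an isometry into \<open>ell2 X\<close> of dense
  range\<close>

context
  fixes V :: "'v hspace" and X :: "'x set" and T :: "'v \<Rightarrow> 'x \<Rightarrow> complex"
  assumes add_closed: "\<And>v w. v \<in> carrier V \<Longrightarrow> w \<in> carrier V \<Longrightarrow> vadd V v w \<in> carrier V"
    and scale_closed: "\<And>c v. v \<in> carrier V \<Longrightarrow> vscale V c v \<in> carrier V"
    and zero_closed: "vzero V \<in> carrier V"
    and T_closed: "\<And>v. v \<in> carrier V \<Longrightarrow> T v \<in> carrier (ell2 X)"
    and T_add: "\<And>v w. v \<in> carrier V \<Longrightarrow> w \<in> carrier V \<Longrightarrow> T (vadd V v w) = (\<lambda>x. T v x + T w x)"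
    and T_scale: "\<And>c v. v \<in> carrier V \<Longrightarrow> T (vscale V c v) = (\<lambda>x. c * T v x)"
    and T_zero: "T (vzero V) = (\<lambda>x. 0)"
    and T_ip: "\<And>v w. v \<in> carrier V \<Longrightarrow> w \<in> carrier V \<Longrightarrow> ip (ell2 X) (T v) (T w) = ip V v w"
    and T_basis: "\<And>x. x \<in> X \<Longrightarrow> basis_vec x \<in> T ` carrier V"
begin

lemma T_vdist:
  assumes "v \<in> carrier V" "w \<in> carrier V"
  shows "vdist V v w = vdist (ell2 X) (T v) (T w)"
  using assms
  by (simp add: vdist_def Let_def ell2_simps(1,3) T_add T_scale add_closed scale_closed flip: T_ip)

lemma T_cauchy:
  assumes "\<And>n. s n \<in> carrier V"
  shows "cauchy_seq V s \<longleftrightarrow> cauchy_seq (ell2 X) (\<lambda>n. T (s n))"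
  using assms by (simp add: cauchy_seq_def T_vdist T_closed)

lemma approx_in: "s \<in> approx_seqs V X T e \<Longrightarrow> s n \<in> carrier V"
  by (simp add: approx_seqs_def)

lemma approx_limit: "s \<in> approx_seqs V X T e \<Longrightarrow> (\<lambda>n. vdist (ell2 X) (T (s n)) e) \<longlonglongrightarrow> 0"
  by (simp add: approx_seqs_def)

lemma approx_cauchy:
  assumes e: "e \<in> carrier (ell2 X)" and s: "s \<in> approx_seqs V X T e"
  shows "cauchy_seq V s"
proof -
  note sV = approx_in[OF s]
  have "\<exists>N. \<forall>p\<ge>N. \<forall>q\<ge>N. vdist (ell2 X) (T (s p)) (T (s q)) < r" if r: "r > 0" for r
  proof -
    obtain N where N: "\<And>n. n \<ge> N \<Longrightarrow> l2norm X (\<lambda>x. T (s n) x - e x) < r / 2"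
      using LIMSEQ_D[OF approx_limit[OF s], of "r/2"] r unfolding ell2_vdist by fastforce
    have "vdist (ell2 X) (T (s p)) (T (s q)) < r" if "p \<ge> N" "q \<ge> N" for p q
      using l2norm_triangle[OF T_closed[OF sV[of p]] e T_closed[OF sV[of q]]]
        N[OF that(1)] N[OF that(2)] l2norm_minus[of X e "T (s q)"] unfolding ell2_vdist by linarith
    then show ?thesis by blast
  qed
  then show ?thesis unfolding T_cauchy[of s, OF sV] by (simp add: cauchy_seq_def T_closed sV)
qed

lemma cauchy_approx:
  assumes "cauchy_seq V s"
  obtains e where "e \<in> carrier (ell2 X)" "s \<in> approx_seqs V X T e"
proof -
  have sV: "s n \<in> carrier V" for n using assms by (simp add: cauchy_seq_def)
  with assms obtain e where "e \<in> carrier (ell2 X)" "(\<lambda>n. vdist (ell2 X) (T (s n)) e) \<longlonglongrightarrow> 0"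
    using ell2_complete T_cauchy by blast
  with that sV show ?thesis by (simp add: approx_seqs_def)
qed

text \<open>The range of \<open>T\<close> is a linear set containing all basis vectors, hence dense,
  and an approximating sequence in the range is lifted termwise to \<open>V\<close>.\<close>

lemma approx_nonempty:
  assumes "e \<in> carrier (ell2 X)"
  obtains s where "s \<in> approx_seqs V X T e"
proof -
  have "\<exists>t. (\<forall>n. t n \<in> T ` carrier V) \<and> (\<lambda>n. vdist (ell2 X) (t n) e) \<longlonglongrightarrow> 0"
  proof (rule ell2_dense[OF _ _ _ T_basis assms])
    fix f g assume "f \<in> T ` carrier V" "g \<in> T ` carrier V"
    then obtain v w where "v \<in> carrier V" "w \<in> carrier V" "f = T v" "g = T w" by blast
    then show "(\<lambda>x. f x + g x) \<in> T ` carrier V"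
      by (intro image_eqI[where x = "vadd V v w"]) (auto simp: T_add add_closed)
  next
    fix c f assume "f \<in> T ` carrier V"
    then obtain v where "v \<in> carrier V" "f = T v" by blast
    then show "(\<lambda>x. c * f x) \<in> T ` carrier V"
      by (intro image_eqI[where x = "vscale V c v"]) (auto simp: T_scale scale_closed)
  next
    show "(\<lambda>x. 0) \<in> T ` carrier V"
      by (intro image_eqI[where x = "vzero V"]) (auto simp: T_zero zero_closed)
  qed
  then obtain t where t: "\<And>n. t n \<in> T ` carrier V" "(\<lambda>n. vdist (ell2 X) (t n) e) \<longlonglongrightarrow> 0" by blast
  then have "\<exists>s. \<forall>n. s n \<in> carrier V \<and> t n = T (s n)" by (intro choice) auto
  then obtain s where "\<And>n. s n \<in> carrier V" "\<And>n. t n = T (s n)" by blast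
  moreover from this t(2) have "(\<lambda>n. vdist (ell2 X) (T (s n)) e) \<longlonglongrightarrow> 0" by simp
  ultimately show ?thesis using that[of s] by (simp add: approx_seqs_def)
qed

text \<open>Two Cauchy sequences are equivalent exactly when their images under \<open>T\<close>
  have the same limit, so one equivalence class consists of all sequences with limit
  \<open>e\<close>. Vectors killed by \<open>T\<close> are the null vectors of \<open>V\<close>,
  which the quotient removes.\<close>

lemma null_rel_approx:
  assumes e: "e \<in> carrier (ell2 X)" and s: "s \<in> approx_seqs V X T e"
  shows "null_rel V `` {s} = approx_seqs V X T e"
proof (intro subset_antisym subsetI)
  note sV = approx_in[OF s]
  fix t
  {
    assume "t \<in> null_rel V `` {s}"
    then have t: "cauchy_seq V t" and d: "(\<lambda>n. vdist V (s n) (t n)) \<longlonglongrightarrow> 0"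
      by (auto simp: null_rel_def)
    have tV: "t n \<in> carrier V" for n using t by (simp add: cauchy_seq_def)
    have "(\<lambda>n. l2norm X (\<lambda>x. T (t n) x - e x)) \<longlonglongrightarrow> 0"
    proof (rule tendsto_sandwich[OF _ _ tendsto_const])
      show "(\<lambda>n. l2norm X (\<lambda>x. T (s n) x - T (t n) x) + l2norm X (\<lambda>x. T (s n) x - e x)) \<longlonglongrightarrow> 0"
        using tendsto_add_zero[OF d approx_limit[OF s]] by (simp add: T_vdist sV tV ell2_vdist)
      show "\<forall>\<^sub>F n in sequentially. l2norm X (\<lambda>x. T (t n) x - e x) \<le>
          l2norm X (\<lambda>x. T (s n) x - T (t n) x) + l2norm X (\<lambda>x. T (s n) x - e x)"
        using l2norm_triangle[OF T_closed[OF tV] T_closed[OF sV] e]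
        by (intro always_eventually allI) (subst (2) l2norm_minus, blast)
    qed auto
    then show "t \<in> approx_seqs V X T e" by (simp add: approx_seqs_def tV ell2_vdist)
  next
    assume t: "t \<in> approx_seqs V X T e"
    note tV = approx_in[OF t]
    have "(\<lambda>n. l2norm X (\<lambda>x. T (s n) x - T (t n) x)) \<longlonglongrightarrow> 0"
    proof (rule tendsto_sandwich[OF _ _ tendsto_const])
      show "(\<lambda>n. l2norm X (\<lambda>x. T (s n) x - e x) + l2norm X (\<lambda>x. T (t n) x - e x)) \<longlonglongrightarrow> 0"
        using tendsto_add_zero[OF approx_limit[OF s] approx_limit[OF t]] by (simp add: ell2_vdist)
      show "\<forall>\<^sub>F n in sequentially. l2norm X (\<lambda>x. T (s n) x - T (t n) x) \<le>
          l2norm X (\<lambda>x. T (s n) x - e x) + l2norm X (\<lambda>x. T (t n) x - e x)"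
        using l2norm_triangle[OF T_closed[OF sV] e T_closed[OF tV]]
        by (intro always_eventually allI) (subst (3) l2norm_minus, blast)
    qed auto
    then show "t \<in> null_rel V `` {s}"
      using approx_cauchy[OF e s] approx_cauchy[OF e t]
      by (simp add: null_rel_def T_vdist sV tV ell2_vdist)
  }
qed

lemma approx_inj:
  assumes e: "e \<in> carrier (ell2 X)" "e' \<in> carrier (ell2 X)"
    and s: "s \<in> approx_seqs V X T e" "s \<in> approx_seqs V X T e'"
  shows "e = e'"
proof -
  note sV = approx_in[OF s(1)]
  have "(\<lambda>n. vdist (ell2 X) (T (s n)) e + vdist (ell2 X) (T (s n)) e') \<longlonglongrightarrow> 0"
    using tendsto_add_zero[OF approx_limit[OF s(1)] approx_limit[OF s(2)]] .
  moreover have "l2norm X (\<lambda>x. e x - e' x) \<le> vdist (ell2 X) (T (s n)) e + vdist (ell2 X) (T (s n)) e'" for n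
    using l2norm_triangle[OF e(1) T_closed[OF sV[of n]] e(2)] l2norm_minus[of X e "T (s n)"]
    by (simp add: ell2_vdist)
  ultimately have "l2norm X (\<lambda>x. e x - e' x) \<le> 0"
    by (intro LIMSEQ_le_const) auto
  then have "l2norm X (\<lambda>x. e x - e' x) = 0" by (simp add: antisym)
  from l2norm_eq_0[OF ell2_diff[OF e] this] show ?thesis by (simp add: fun_eq_iff)
qed

text \<open>One inclusion is completeness of \<open>ell2 X\<close>, through
  \<open>cauchy_approx\<close>; the other is density of the range of \<open>T\<close>, through
  \<open>approx_nonempty\<close>.\<close>

lemma completion_carrier: "carrier (completion V) = approx_seqs V X T ` carrier (ell2 X)"
proof (intro subset_antisym subsetI)
  fix A assume "A \<in> carrier (completion V)"
  then obtain s where "cauchy_seq V s" "A = null_rel V `` {s}"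
    by (auto simp: completion_def quotient_def)
  then show "A \<in> approx_seqs V X T ` carrier (ell2 X)"
    by (elim cauchy_approx) (auto simp: null_rel_approx)
next
  fix A assume "A \<in> approx_seqs V X T ` carrier (ell2 X)"
  then obtain e where e: "e \<in> carrier (ell2 X)" "A = approx_seqs V X T e" by blast
  obtain s where "s \<in> approx_seqs V X T e" using e(1) by (rule approx_nonempty)
  with e show "A \<in> carrier (completion V)"
    using null_rel_approx[of e s] approx_cauchy[of e s] by (auto simp: completion_def quotient_def)
qed

lemma approx_add:
  assumes e: "e \<in> carrier (ell2 X)" "f \<in> carrier (ell2 X)"
    and s: "s \<in> approx_seqs V X T e" and t: "t \<in> approx_seqs V X T f"
  shows "(\<lambda>n. vadd V (s n) (t n)) \<in> approx_seqs V X T (\<lambda>x. e x + f x)"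
proof -
  note V = approx_in[OF s] approx_in[OF t]
  have "(\<lambda>n. l2norm X (\<lambda>x. (T (s n) x + T (t n) x) - (e x + f x))) \<longlonglongrightarrow> 0"
  proof (rule tendsto_sandwich[OF _ _ tendsto_const])
    show "(\<lambda>n. l2norm X (\<lambda>x. T (s n) x - e x) + l2norm X (\<lambda>x. T (t n) x - f x)) \<longlonglongrightarrow> 0"
      using tendsto_add_zero[OF approx_limit[OF s] approx_limit[OF t]] by (simp add: ell2_vdist)
    have "l2norm X (\<lambda>x. (T (s n) x - e x) + (T (t n) x - f x)) \<le>
        l2norm X (\<lambda>x. T (s n) x - e x) + l2norm X (\<lambda>x. T (t n) x - f x)" for n
      by (intro l2norm_add ell2_diff T_closed V e)
    then show "\<forall>\<^sub>F n in sequentially. l2norm X (\<lambda>x. (T (s n) x + T (t n) x) - (e x + f x)) \<le>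
        l2norm X (\<lambda>x. T (s n) x - e x) + l2norm X (\<lambda>x. T (t n) x - f x)"
      by (intro always_eventually allI) (simp add: algebra_simps)
  qed auto
  then show ?thesis by (simp add: approx_seqs_def V add_closed T_add ell2_vdist)
qed

lemma approx_scale:
  assumes "e \<in> carrier (ell2 X)" and s: "s \<in> approx_seqs V X T e"
  shows "(\<lambda>n. vscale V c (s n)) \<in> approx_seqs V X T (\<lambda>x. c * e x)"
proof -
  note V = approx_in[OF s]
  have "(\<lambda>n. cmod c * l2norm X (\<lambda>x. T (s n) x - e x)) \<longlonglongrightarrow> 0"
    using approx_limit[OF s] unfolding ell2_vdist by (rule tendsto_mult_right_zero)
  then show ?thesis
    by (simp add: approx_seqs_def V scale_closed T_scale ell2_vdist flip: l2norm_scale right_diff_distrib)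
qed

lemma unitary_map_approx_seqs: "unitary_map (ell2 X) (completion V) (approx_seqs V X T)"
  unfolding unitary_map_def
proof (intro conjI ballI allI)
  have "inj_on (approx_seqs V X T) (carrier (ell2 X))"
    by (rule inj_onI) (metis approx_inj approx_nonempty)
  then show "bij_betw (approx_seqs V X T) (carrier (ell2 X)) (carrier (completion V))"
    by (simp add: bij_betw_def completion_carrier)
next
  fix c :: complex and e assume e: "e \<in> carrier (ell2 X)"
  obtain s where "s \<in> approx_seqs V X T e" using e by (rule approx_nonempty)
  \<comment> \<open>Every representative \<open>a\<close> gives the same class, and at least one
    exists, so the union in the definition of \<open>vscale\<close> collapses to that class.
    Addition is handled in the same way.\<close>
  moreover have "null_rel V `` {\<lambda>n. vscale V c (a n)} = approx_seqs V X T (\<lambda>x. c * e x)"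
    if "a \<in> approx_seqs V X T e" for a
    using e that by (intro null_rel_approx approx_scale ell2_scale)
  ultimately show "approx_seqs V X T (vscale (ell2 X) c e) = vscale (completion V) c (approx_seqs V X T e)"
    by (auto simp: completion_def ell2_simps(3))
next
  fix e f assume e: "e \<in> carrier (ell2 X)" "f \<in> carrier (ell2 X)"
  obtain s where s: "s \<in> approx_seqs V X T e" using e(1) by (rule approx_nonempty)
  obtain t where t: "t \<in> approx_seqs V X T f" using e(2) by (rule approx_nonempty)
  have "null_rel V `` {\<lambda>n. vadd V (a n) (b n)} = approx_seqs V X T (\<lambda>x. e x + f x)"
    if "a \<in> approx_seqs V X T e" "b \<in> approx_seqs V X T f" for a b
    using e that by (intro null_rel_approx approx_add l2norm_add)
  with s t show "approx_seqs V X T (vadd (ell2 X) e f) =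
      vadd (completion V) (approx_seqs V X T e) (approx_seqs V X T f)"
    by (auto simp: completion_def ell2_simps(1))
  have lim: "(\<lambda>n. ip V (a n) (b n)) \<longlonglongrightarrow> ip (ell2 X) e f"
    if "a \<in> approx_seqs V X T e" "b \<in> approx_seqs V X T f" for a b
  proof -
    note V = approx_in[OF that(1)] approx_in[OF that(2)]
    have "(\<lambda>n. ip (ell2 X) (T (a n)) (T (b n))) \<longlonglongrightarrow> ip (ell2 X) e f"
      by (intro ell2_ip_tendsto e T_closed V approx_limit that)
    then show ?thesis by (simp add: T_ip V)
  qed
  \<comment> \<open>The description is well defined because representatives exist and limits are
    unique.\<close>
  then have "(THE z. \<forall>a\<in>approx_seqs V X T e. \<forall>b\<in>approx_seqs V X T f.
      (\<lambda>n. ip V (a n) (b n)) \<longlonglongrightarrow> z) = ip (ell2 X) e f"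
    using s t LIMSEQ_unique by (intro the_equality) blast+
  then show "ip (completion V) (approx_seqs V X T e) (approx_seqs V X T f) = ip (ell2 X) e f"
    by (simp add: completion_def)
qed

text \<open>\<open>L\<close> preserves distances, so if \<open>T (a n)\<close> tends to
  \<open>e\<close>, then \<open>T (M (a n)) = L (T (a n))\<close> tends to
  \<open>L e\<close>.\<close>

lemma completion_map_approx_seqs:
  assumes M: "\<And>v. v \<in> carrier V \<Longrightarrow> M v \<in> carrier V"
    and TM: "\<And>v. v \<in> carrier V \<Longrightarrow> T (M v) = L (T v)"
    and L: "\<And>e. e \<in> carrier (ell2 X) \<Longrightarrow> L e \<in> carrier (ell2 X)"
    and iso: "\<And>e f. e \<in> carrier (ell2 X) \<Longrightarrow> f \<in> carrier (ell2 X) \<Longrightarrow>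
      vdist (ell2 X) (L e) (L f) = vdist (ell2 X) e f"
    and e: "e \<in> carrier (ell2 X)"
  shows "completion_map V M (approx_seqs V X T e) = approx_seqs V X T (L e)"
proof -
  obtain s where "s \<in> approx_seqs V X T e" using e by (rule approx_nonempty)
  moreover have "null_rel V `` {\<lambda>n. M (a n)} = approx_seqs V X T (L e)"
    if a: "a \<in> approx_seqs V X T e" for a
  proof (rule null_rel_approx[OF L[OF e]])
    show "(\<lambda>n. M (a n)) \<in> approx_seqs V X T (L e)"
      using approx_limit[OF a] by (simp add: approx_seqs_def approx_in[OF a] M TM iso T_closed e)
  qed
  ultimately show ?thesis by (auto simp: completion_map_def)
qed

end

section \<open>Tensor products of \<open>ell2\<close> spaces\<close>

text \<open>Absolute summability of both families makes the products absolutely summable over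
  \<open>A \<times> B\<close>, so the sum may be iterated and factors. Norms and inner products of
  elementary tensors are computed from this.\<close>

lemma has_sum_mult_Times:
  fixes f :: "'a \<Rightarrow> 'c::{real_normed_field,banach}" and g :: "'b \<Rightarrow> 'c"
  assumes f: "f abs_summable_on A" and g: "g abs_summable_on B"
  shows "((\<lambda>(x, y). f x * g y) has_sum (infsum f A * infsum g B)) (A \<times> B)"
proof -
  have "(\<lambda>(x, y). f x * g y) abs_summable_on A \<times> B"
    unfolding abs_summable_on_Sigma_iff using f g
    by (auto simp: norm_mult infsum_cmult_right' abs_mult infsum_nonneg intro: summable_on_cmult_right summable_on_cmult_left)
  then have summ: "(\<lambda>(x, y). f x * g y) summable_on A \<times> B"
    by (rule abs_summable_summable)
  have "infsum (\<lambda>(x, y). f x * g y) (A \<times> B) = infsum f A * infsum g B"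
    using infsum_Sigma_banach[OF summ] by (simp add: infsum_cmult_right' infsum_cmult_left')
  with has_sum_infsum[OF summ] show ?thesis by simp
qed

text \<open>The bijection \<open>\<beta>\<close> identifies \<open>\<ell>\<^sup>2(Z)\<close> with \<open>\<ell>\<^sup>2(X \<times> Y)\<close>.\<close>

definition tensor_fun ::
  "'z set \<Rightarrow> ('z \<Rightarrow> 'x \<times> 'y) \<Rightarrow> ('x \<Rightarrow> complex) \<times> ('y \<Rightarrow> complex) \<Rightarrow> 'z \<Rightarrow> complex" where
  "tensor_fun Z \<beta> p C = (if C \<in> Z then fst p (fst (\<beta> C)) * snd p (snd (\<beta> C)) else 0)"

text \<open>This linear map takes the role of \<open>T\<close> in the completion lemmas: the pair
  \<open>(f, g)\<close> goes to the function \<open>f(x) g(y)\<close>, transported to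
  \<open>Z\<close>.\<close>

definition tensor_eval ::
  "'z set \<Rightarrow> ('z \<Rightarrow> 'x \<times> 'y) \<Rightarrow> (('x \<Rightarrow> complex) \<times> ('y \<Rightarrow> complex) \<Rightarrow>\<^sub>0 complex) \<Rightarrow> 'z \<Rightarrow> complex" where
  "tensor_eval Z \<beta> a = (\<lambda>C. \<Sum>p\<in>Poly_Mapping.keys a. Poly_Mapping.lookup a p * tensor_fun Z \<beta> p C)"

text \<open>Keys outside the support have coefficient 0. Enlarging the index set matters because
  addition and scaling can cancel coefficients and so change the set of keys.\<close>

lemma tensor_eval_superset:
  assumes "finite F" "Poly_Mapping.keys a \<subseteq> F"
  shows "tensor_eval Z \<beta> a C = (\<Sum>p\<in>F. Poly_Mapping.lookup a p * tensor_fun Z \<beta> p C)"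
  unfolding tensor_eval_def using assms
  by (intro sum.mono_neutral_left) (auto simp: in_keys_iff)

lemma tensor_eval_add: "tensor_eval Z \<beta> (a + b) = (\<lambda>C. tensor_eval Z \<beta> a C + tensor_eval Z \<beta> b C)"
proof
  fix C
  let ?F = "Poly_Mapping.keys a \<union> Poly_Mapping.keys b"
  show "tensor_eval Z \<beta> (a + b) C = tensor_eval Z \<beta> a C + tensor_eval Z \<beta> b C"
    using keys_add[of a b] tensor_eval_superset[of ?F _ Z \<beta> C]
    by (simp add: lookup_add algebra_simps sum.distrib)
qed

lemma lookup_map_times: "Poly_Mapping.lookup (Poly_Mapping.map ((*) c) a) p = c * Poly_Mapping.lookup a p"
  for a :: "'p \<Rightarrow>\<^sub>0 complex"
  by (simp add: Poly_Mapping.map.rep_eq when_def)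

lemma keys_map_times: "Poly_Mapping.keys (Poly_Mapping.map ((*) c) a) \<subseteq> Poly_Mapping.keys a"
  for a :: "'p \<Rightarrow>\<^sub>0 complex"
  by (auto simp: in_keys_iff lookup_map_times)

lemma tensor_eval_scale:
  "tensor_eval Z \<beta> (Poly_Mapping.map ((*) c) a) = (\<lambda>C. c * tensor_eval Z \<beta> a C)"
  using tensor_eval_superset[OF finite_keys keys_map_times[of c a], of Z \<beta>]
  by (auto simp: fun_eq_iff tensor_eval_def lookup_map_times sum_distrib_left mult.assoc)

lemma tensor_eval_zero [simp]: "tensor_eval Z \<beta> 0 = (\<lambda>C. 0)"
  by (simp add: tensor_eval_def)

lemma tensor_eval_single: "tensor_eval Z \<beta> (Poly_Mapping.single p c) = (\<lambda>C. c * tensor_fun Z \<beta> p C)"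
  by (auto simp: fun_eq_iff tensor_eval_def)

lemma tensor_eval_sum:
  "tensor_eval Z \<beta> (\<Sum>i\<in>I. a i) = (\<lambda>C. \<Sum>i\<in>I. tensor_eval Z \<beta> (a i) C)"
  by (induction I rule: infinite_finite_induct) (auto simp: tensor_eval_add)

lemma alg_tensor_simps:
  "carrier (alg_tensor V W) = {a. Poly_Mapping.keys a \<subseteq> carrier V \<times> carrier W}"
  "vadd (alg_tensor V W) a b = a + b" "vzero (alg_tensor V W) = 0"
  "vscale (alg_tensor V W) c a = Poly_Mapping.map ((*) c) a"
  by (simp_all add: alg_tensor_def)

lemma alg_tensor_add_closed:
  assumes "a \<in> carrier (alg_tensor V W)" "b \<in> carrier (alg_tensor V W)"
  shows "a + b \<in> carrier (alg_tensor V W)"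
  using assms keys_add[of a b] by (auto simp: alg_tensor_simps)

lemma alg_tensor_map_closed:
  assumes S: "\<And>v. v \<in> carrier V \<Longrightarrow> S v \<in> carrier V" and R: "\<And>w. w \<in> carrier W \<Longrightarrow> R w \<in> carrier W"
    and a: "a \<in> carrier (alg_tensor V W)"
  shows "alg_tensor_map S R a \<in> carrier (alg_tensor V W)"
proof -
  \<comment> \<open>Images of distinct keys may coincide and their coefficients cancel, so the keys
    of the sum are not computed; an induction on \<open>F\<close> uses closure under addition
    instead.\<close>
  have "(\<Sum>p\<in>F. Poly_Mapping.single (S (fst p), R (snd p)) (Poly_Mapping.lookup a p)) \<in> carrier (alg_tensor V W)"
    if "F \<subseteq> carrier V \<times> carrier W" for F
    using that
  proof (induction F rule: infinite_finite_induct)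
    case (insert p F)
    then show ?case
      using S R by (simp del: fst_conv, intro alg_tensor_add_closed) (auto simp: alg_tensor_simps)
  qed (auto simp: alg_tensor_simps)
  then show ?thesis using a by (simp add: alg_tensor_map_def alg_tensor_simps)
qed

context
  fixes X :: "'x set" and Y :: "'y set" and Z :: "'z set" and \<beta> :: "'z \<Rightarrow> 'x \<times> 'y"
  assumes bij: "bij_betw \<beta> Z (X \<times> Y)"
begin

lemma tensor_fun_ell2:
  assumes "f \<in> carrier (ell2 X)" "g \<in> carrier (ell2 Y)"
  shows "tensor_fun Z \<beta> (f, g) \<in> carrier (ell2 Z)"
proof -
  have "(\<lambda>(x, y). (cmod (f x))\<^sup>2 * (cmod (g y))\<^sup>2) summable_on X \<times> Y"
    using assms by (intro has_sum_imp_summable[OF has_sum_mult_Times]) (simp_all add: ell2_iff)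
  then have "(\<lambda>C. (cmod (f (fst (\<beta> C))))\<^sup>2 * (cmod (g (snd (\<beta> C))))\<^sup>2) summable_on Z"
    using summable_on_reindex_bij_betw[OF bij] by (fastforce simp: case_prod_unfold)
  then show ?thesis
    by (simp add: ell2_iff tensor_fun_def norm_mult power_mult_distrib cong: summable_on_cong)
qed

lemma tensor_fun_ip:
  assumes "f \<in> carrier (ell2 X)" "g \<in> carrier (ell2 Y)" "f' \<in> carrier (ell2 X)" "g' \<in> carrier (ell2 Y)"
  shows "ip (ell2 Z) (tensor_fun Z \<beta> (f, g)) (tensor_fun Z \<beta> (f', g')) = ip (ell2 X) f f' * ip (ell2 Y) g g'"
proof -
  have "((\<lambda>(x, y). (cnj (f x) * f' x) * (cnj (g y) * g' y)) has_sum (ip (ell2 X) f f' * ip (ell2 Y) g g')) (X \<times> Y)"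
    unfolding ell2_simps using assms by (intro has_sum_mult_Times ell2_ip_summable)
  then have "((\<lambda>C. (cnj (f (fst (\<beta> C))) * f' (fst (\<beta> C))) * (cnj (g (snd (\<beta> C))) * g' (snd (\<beta> C))))
      has_sum (ip (ell2 X) f f' * ip (ell2 Y) g g')) Z"
    using has_sum_reindex_bij_betw[OF bij] by (fastforce simp: case_prod_unfold)
  then have "((\<lambda>C. cnj (tensor_fun Z \<beta> (f, g) C) * tensor_fun Z \<beta> (f', g') C)
      has_sum (ip (ell2 X) f f' * ip (ell2 Y) g g')) Z"
    by (rule has_sum_cong[THEN iffD1, rotated]) (simp add: tensor_fun_def)
  then show ?thesis unfolding ell2_simps(4)[of Z] by (rule infsumI)
qed

lemma tensor_eval_ell2:
  assumes "a \<in> carrier (alg_tensor (ell2 X) (ell2 Y))"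
  shows "tensor_eval Z \<beta> a \<in> carrier (ell2 Z)"
  unfolding tensor_eval_def
proof (intro ell2_sum ell2_scale)
  fix p assume "p \<in> Poly_Mapping.keys a"
  then have "p \<in> carrier (ell2 X) \<times> carrier (ell2 Y)" using assms by (auto simp: alg_tensor_simps)
  then show "tensor_fun Z \<beta> p \<in> carrier (ell2 Z)" by (cases p) (simp add: tensor_fun_ell2)
qed

lemma tensor_eval_ip:
  assumes a: "a \<in> carrier (alg_tensor (ell2 X) (ell2 Y))" and b: "b \<in> carrier (alg_tensor (ell2 X) (ell2 Y))"
  shows "ip (ell2 Z) (tensor_eval Z \<beta> a) (tensor_eval Z \<beta> b) = ip (alg_tensor (ell2 X) (ell2 Y)) a b"
proof -
  have keys: "fst p \<in> carrier (ell2 X)" "snd p \<in> carrier (ell2 Y)"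
    if "p \<in> Poly_Mapping.keys a \<union> Poly_Mapping.keys b" for p
    using that a b by (auto simp: alg_tensor_simps)
  have fun_in: "tensor_fun Z \<beta> p \<in> carrier (ell2 Z)" if "p \<in> Poly_Mapping.keys a \<union> Poly_Mapping.keys b" for p
    using tensor_fun_ell2[OF keys[OF that]] by simp
  have "ip (ell2 Z) (tensor_eval Z \<beta> a) (tensor_eval Z \<beta> b) =
      (\<Sum>p\<in>Poly_Mapping.keys a. cnj (Poly_Mapping.lookup a p) * ip (ell2 Z) (tensor_fun Z \<beta> p) (tensor_eval Z \<beta> b))"
    unfolding tensor_eval_def[of Z \<beta> a]
    by (intro ell2_ip_sum_left tensor_eval_ell2 b) (simp add: fun_in)
  also have "\<dots> = (\<Sum>p\<in>Poly_Mapping.keys a. cnj (Poly_Mapping.lookup a p) *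
      (\<Sum>q\<in>Poly_Mapping.keys b. Poly_Mapping.lookup b q *
        (ip (ell2 X) (fst p) (fst q) * ip (ell2 Y) (snd p) (snd q))))"
  proof (intro sum.cong refl arg_cong2[where f = "(*)"])
    fix p assume p: "p \<in> Poly_Mapping.keys a"
    have "ip (ell2 Z) (tensor_fun Z \<beta> p) (tensor_eval Z \<beta> b) =
        (\<Sum>q\<in>Poly_Mapping.keys b. Poly_Mapping.lookup b q * ip (ell2 Z) (tensor_fun Z \<beta> p) (tensor_fun Z \<beta> q))"
      unfolding tensor_eval_def by (intro ell2_ip_sum_right) (use p in \<open>simp_all add: fun_in\<close>)
    also have "\<dots> = (\<Sum>q\<in>Poly_Mapping.keys b. Poly_Mapping.lookup b q *
        (ip (ell2 X) (fst p) (fst q) * ip (ell2 Y) (snd p) (snd q)))"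
    proof (intro sum.cong refl arg_cong2[where f = "(*)"])
      fix q assume "q \<in> Poly_Mapping.keys b"
      then show "ip (ell2 Z) (tensor_fun Z \<beta> p) (tensor_fun Z \<beta> q) =
          ip (ell2 X) (fst p) (fst q) * ip (ell2 Y) (snd p) (snd q)"
        using tensor_fun_ip[OF keys keys, of p p q q] p by simp
    qed
    finally show "ip (ell2 Z) (tensor_fun Z \<beta> p) (tensor_eval Z \<beta> b) =
        (\<Sum>q\<in>Poly_Mapping.keys b. Poly_Mapping.lookup b q *
          (ip (ell2 X) (fst p) (fst q) * ip (ell2 Y) (snd p) (snd q)))" .
  qed
  also have "\<dots> = ip (alg_tensor (ell2 X) (ell2 Y)) a b"
    by (simp add: alg_tensor_def sum_distrib_left mult.assoc)
  finally show ?thesis .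
qed

text \<open>The basis vector at \<open>C\<close> is the elementary tensor of the basis vectors at
  the two components of \<open>\<beta> C\<close>; injectivity of \<open>\<beta>\<close> ensures that
  it vanishes elsewhere. This gives density of the range.\<close>

lemma tensor_eval_basis:
  assumes C: "C \<in> Z"
  shows "basis_vec C \<in> tensor_eval Z \<beta> ` carrier (alg_tensor (ell2 X) (ell2 Y))"
proof (rule image_eqI)
  let ?p = "(basis_vec (fst (\<beta> C)), basis_vec (snd (\<beta> C)))"
  have "\<beta> C \<in> X \<times> Y" using bij C by (auto simp: bij_betw_def)
  then show "Poly_Mapping.single ?p 1 \<in> carrier (alg_tensor (ell2 X) (ell2 Y))"
    by (auto simp: alg_tensor_simps basis_vec_ell2)
  have "D = C" if "D \<in> Z" "fst (\<beta> D) = fst (\<beta> C)" "snd (\<beta> D) = snd (\<beta> C)" for D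
    using inj_onD[OF bij_betw_imp_inj_on[OF bij] _ that(1) C] that by (simp add: prod_eq_iff)
  then show "basis_vec C = tensor_eval Z \<beta> (Poly_Mapping.single ?p 1)"
    using C by (auto simp: tensor_eval_single fun_eq_iff tensor_fun_def basis_vec_def)
qed

text \<open>The completion lemmas with \<open>T = tensor_eval Z \<beta>\<close>. In the second part
  \<open>L\<close> is the form that the tensor product of \<open>S\<close> and \<open>R\<close>
  takes on \<open>ell2 Z\<close>; the intertwining identity is checked on algebraic tensors and
  extends by continuity.\<close>

lemma tensor_unitary:
  shows "unitary_map (ell2 Z) (hilbert_tensor (ell2 X) (ell2 Y))
      (approx_seqs (alg_tensor (ell2 X) (ell2 Y)) Z (tensor_eval Z \<beta>))"
    and "\<lbrakk>\<And>f. f \<in> carrier (ell2 X) \<Longrightarrow> S f \<in> carrier (ell2 X); \<And>g. g \<in> carrier (ell2 Y) \<Longrightarrow> R g \<in> carrier (ell2 Y);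
      \<And>a. a \<in> carrier (alg_tensor (ell2 X) (ell2 Y)) \<Longrightarrow>
        tensor_eval Z \<beta> (alg_tensor_map S R a) = L (tensor_eval Z \<beta> a);
      \<And>e. e \<in> carrier (ell2 Z) \<Longrightarrow> L e \<in> carrier (ell2 Z);
      \<And>e f. e \<in> carrier (ell2 Z) \<Longrightarrow> f \<in> carrier (ell2 Z) \<Longrightarrow> vdist (ell2 Z) (L e) (L f) = vdist (ell2 Z) e f;
      e \<in> carrier (ell2 Z)\<rbrakk> \<Longrightarrow>
      tensor_map (ell2 X) (ell2 Y) S R (approx_seqs (alg_tensor (ell2 X) (ell2 Y)) Z (tensor_eval Z \<beta>) e) =
      approx_seqs (alg_tensor (ell2 X) (ell2 Y)) Z (tensor_eval Z \<beta>) (L e)"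
proof -
  let ?V = "alg_tensor (ell2 X) (ell2 Y)"
  have add: "vadd ?V v w \<in> carrier ?V" if "v \<in> carrier ?V" "w \<in> carrier ?V" for v w
    using alg_tensor_add_closed[OF that] by (simp add: alg_tensor_simps)
  have scale: "vscale ?V c v \<in> carrier ?V" if "v \<in> carrier ?V" for c v
    using that keys_map_times[of c v] by (auto simp: alg_tensor_simps)
  have zero: "vzero ?V \<in> carrier ?V" by (simp add: alg_tensor_simps)
  have lin: "tensor_eval Z \<beta> (vadd ?V v w) = (\<lambda>x. tensor_eval Z \<beta> v x + tensor_eval Z \<beta> w x)"
    "tensor_eval Z \<beta> (vscale ?V c v) = (\<lambda>x. c * tensor_eval Z \<beta> v x)"
    "tensor_eval Z \<beta> (vzero ?V) = (\<lambda>x. 0)" for v w c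
    by (simp_all add: alg_tensor_simps tensor_eval_add tensor_eval_scale)
  note facts = add scale zero tensor_eval_ell2 lin tensor_eval_ip tensor_eval_basis
  show "unitary_map (ell2 Z) (hilbert_tensor (ell2 X) (ell2 Y)) (approx_seqs ?V Z (tensor_eval Z \<beta>))"
    unfolding hilbert_tensor_def by (rule unitary_map_approx_seqs) (intro facts; assumption)+
  assume "\<And>f. f \<in> carrier (ell2 X) \<Longrightarrow> S f \<in> carrier (ell2 X)" "\<And>g. g \<in> carrier (ell2 Y) \<Longrightarrow> R g \<in> carrier (ell2 Y)"
    and *: "\<And>a. a \<in> carrier ?V \<Longrightarrow> tensor_eval Z \<beta> (alg_tensor_map S R a) = L (tensor_eval Z \<beta> a)"
      "\<And>e. e \<in> carrier (ell2 Z) \<Longrightarrow> L e \<in> carrier (ell2 Z)"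
      "\<And>e f. e \<in> carrier (ell2 Z) \<Longrightarrow> f \<in> carrier (ell2 Z) \<Longrightarrow> vdist (ell2 Z) (L e) (L f) = vdist (ell2 Z) e f"
      "e \<in> carrier (ell2 Z)"
  then have closed: "alg_tensor_map S R a \<in> carrier ?V" if "a \<in> carrier ?V" for a
    using that by (intro alg_tensor_map_closed)
  show "tensor_map (ell2 X) (ell2 Y) S R (approx_seqs ?V Z (tensor_eval Z \<beta>) e) =
      approx_seqs ?V Z (tensor_eval Z \<beta>) (L e)"
    unfolding tensor_map_def by (rule completion_map_approx_seqs) (intro facts closed *; assumption)+
qed

end

section \<open>Free groups and the subgroups \<open>K\<^sub>l\<close>\<close>

lemma free_group_hom_eqI:
  assumes "group G" "h \<in> hom (free_group S) G" "h' \<in> hom (free_group S) G"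
    and "\<And>i. i \<in> S \<Longrightarrow> h (gen i) = h' (gen i)" "w \<in> carrier (free_group S)"
  shows "h w = h' w"
proof -
  have "h w = free_lift G (\<lambda>i. h' (gen i)) w" by (rule free_lift_unique[OF assms(1,2,4,5)])
  also have "\<dots> = h' w" by (rule free_lift_unique[OF assms(1,3) refl assms(5), symmetric])
  finally show ?thesis .
qed

section \<open>Exponent sums\<close>

text \<open>The homomorphism to the integers with value \<open>c i\<close> on the generator
  \<open>i\<close>. The constant 1 gives the total exponent sum, and an indicator function gives the
  exponent sum of one generator.\<close>

definition weight :: "('a \<Rightarrow> int) \<Rightarrow> 'a word \<Rightarrow> int" where
  "weight c w = (\<Sum>a\<leftarrow>w. if snd a then c (fst a) else - c (fst a))"

lemma weight_red_cons: "weight c (red_cons a w) = weight c (a # w)"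
  by (cases w) (auto simp: weight_def inv_letter_def)

lemma weight_foldr: "weight c (foldr red_cons u v) = weight c u + weight c v"
  by (induction u) (auto simp: weight_red_cons, auto simp: weight_def)

lemma weight_hom: "weight c \<in> hom (free_group S) integer_group"
  by (rule homI) (auto simp: free_group_def weight_foldr)

lemma weight_gen [simp]: "weight c (gen i) = c i"
  by (simp add: weight_def gen_def)

lemma weight_mult: "weight c (u \<otimes>\<^bsub>free_group S\<^esub> v) = weight c u + weight c v"
  by (simp add: free_group_def weight_foldr)

lemma weight_int_pow:
  assumes "w \<in> carrier (free_group S)"
  shows "weight c (w [^]\<^bsub>free_group S\<^esub> (k::int)) = k * weight c w"
proof -
  interpret group_hom "free_group S" integer_group "weight c"
    by (intro group_hom.intro group_hom_axioms.intro group_free_group group_integer_group weight_hom)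
  show ?thesis using hom_int_pow[OF assms, of k] by simp
qed

lemma weight_inv:
  assumes "w \<in> carrier (free_group S)"
  shows "weight c (inv\<^bsub>free_group S\<^esub> w) = - weight c w"
proof -
  interpret group_hom "free_group S" integer_group "weight c"
    by (intro group_hom.intro group_hom_axioms.intro group_free_group group_integer_group weight_hom)
  show ?thesis using hom_inv[OF assms] by simp
qed

section \<open>Reduced words and the centraliser of a power of a generator\<close>

lemma foldr_red_cons_length: "length (foldr red_cons u v) \<le> length u + length v"
proof (induction u)
  case (Cons a u)
  have "length (red_cons a w) \<le> Suc (length w)" for w by (cases w) auto
  from this[of "foldr red_cons u v"] Cons show ?case by simp
qed simp

text \<open>Each cancellation loses two letters compared with concatenation, so a product of full
  length involves none.\<close>

lemma foldr_red_cons_append: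
  "length (foldr red_cons u v) = length u + length v \<Longrightarrow> foldr red_cons u v = u @ v"
proof (induction u)
  case (Cons a u)
  let ?w = "foldr red_cons u v"
  have "red_cons a ?w = a # ?w \<or> length (red_cons a ?w) < length ?w" by (cases ?w) auto
  then show ?case
  proof
    assume *: "red_cons a ?w = a # ?w"
    then have "length ?w = length u + length v" using Cons.prems by simp
    with Cons.IH * show ?case by simp
  next
    assume "length (red_cons a ?w) < length ?w"
    with Cons.prems foldr_red_cons_length[of u v] show ?case by simp
  qed
qed simp

lemma gen_nat_pow: "gen i [^]\<^bsub>free_group S\<^esub> (k::nat) = replicate k (i, True)"
proof (induction k)
  case (Suc k)
  \<comment> \<open>Powers grow by multiplication on the right, so the effect of a block of equal
    letters on a single generator is computed first.\<close>
  have "foldr red_cons (replicate k (i, True)) [(i, True)] = replicate (Suc k) (i, True)" for k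
  proof (induction k)
    case (Suc k)
    then show ?case by (simp add: inv_letter_def)
  qed simp
  then show ?case using Suc by (simp add: nat_pow_def free_group_def gen_def)
qed (simp add: free_group_def nat_pow_def)

lemma gen_letter_in_range:
  assumes "i \<in> S"
  shows "[(i, b)] \<in> range (\<lambda>s::int. gen i [^]\<^bsub>free_group S\<^esub> s)"
proof -
  interpret group "free_group S" by (rule group_free_group)
  note g = gen_in_free_group[OF assms]
  show ?thesis
  proof (cases b)
    case True
    have "[(i, b)] = gen i [^]\<^bsub>free_group S\<^esub> (1::int)" using g True by (simp add: gen_def)
    then show ?thesis by blast
  next
    case False
    have "[(i, b)] \<otimes>\<^bsub>free_group S\<^esub> gen i = \<one>\<^bsub>free_group S\<^esub>"
      using False by (simp add: gen_def free_group_def inv_letter_def)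
    moreover have "[(i, b)] \<in> carrier (free_group S)" using assms by (simp add: free_group_def)
    ultimately have "[(i, b)] = gen i [^]\<^bsub>free_group S\<^esub> (-1::int)"
      using g inv_equality[of "[(i, b)]" "gen i"] by (simp add: int_pow_neg)
    then show ?thesis by blast
  qed
qed

text \<open>If \<open>u\<close> begins with a letter other than \<open>g\<^sub>i\<^sup>\<plusminus>\<^sup>1\<close>, then \<open>g\<^sub>i\<^sup>k u\<close> is reduced as written, so
  \<open>u g\<^sub>i\<^sup>k\<close> has the same full length and begins with the first letter of \<open>u\<close>, a contradiction.\<close>

lemma commutes_gen_pow:
  assumes i: "i \<in> S" and k: "k > (0::nat)" and u: "u \<in> carrier (free_group S)"
    and comm: "gen i [^]\<^bsub>free_group S\<^esub> k \<otimes>\<^bsub>free_group S\<^esub> u = u \<otimes>\<^bsub>free_group S\<^esub> gen i [^]\<^bsub>free_group S\<^esub> k"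
  shows "u \<in> range (\<lambda>s::int. gen i [^]\<^bsub>free_group S\<^esub> s)"
  using u comm
proof (induction u rule: length_induct)
  case (1 u)
  interpret group "free_group S" by (rule group_free_group)
  note g = gen_in_free_group[OF i]
  let ?g = "gen i [^]\<^bsub>free_group S\<^esub> k"
  show ?case
  proof (cases u)
    case Nil
    then have "u = gen i [^]\<^bsub>free_group S\<^esub> (0::int)" by (simp add: free_group_def)
    then show ?thesis by blast
  next
    case (Cons a w)
    have w: "w \<in> carrier (free_group S)" and red: "reduced (a # w)" and aS: "fst a \<in> S"
      using 1(2) Cons by (auto simp: free_group_def dest: reduced_tl)
    show ?thesis
    proof (cases "fst a = i")
      case True
      \<comment> \<open>Here the first letter of \<open>u\<close> is itself a power of
        \<open>gen i\<close> and commutes with \<open>?g\<close>. It can be cancelled from the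
        commutation relation, and the shorter word \<open>w\<close> satisfies the induction
        hypothesis.\<close>
      obtain s :: int where s: "[a] = gen i [^]\<^bsub>free_group S\<^esub> s"
        using gen_letter_in_range[OF i, of "snd a"] True by (cases a) auto
      have a: "[a] \<in> carrier (free_group S)" using aS by (simp add: free_group_def)
      have u: "u = [a] \<otimes>\<^bsub>free_group S\<^esub> w"
        using red Cons by (cases w) (auto simp: free_group_def)
      have "?g \<otimes>\<^bsub>free_group S\<^esub> [a] = [a] \<otimes>\<^bsub>free_group S\<^esub> ?g"
        unfolding s using g by (simp add: add.commute flip: int_pow_mult int_pow_int)
      then have "[a] \<otimes>\<^bsub>free_group S\<^esub> (?g \<otimes>\<^bsub>free_group S\<^esub> w) = ?g \<otimes>\<^bsub>free_group S\<^esub> u"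
        using g a w unfolding u by (simp flip: m_assoc)
      also have "\<dots> = [a] \<otimes>\<^bsub>free_group S\<^esub> (w \<otimes>\<^bsub>free_group S\<^esub> ?g)"
        using g a w 1(3) unfolding u by (simp add: m_assoc)
      finally have "?g \<otimes>\<^bsub>free_group S\<^esub> w = w \<otimes>\<^bsub>free_group S\<^esub> ?g"
        using g a w by simp
      then obtain t :: int where "w = gen i [^]\<^bsub>free_group S\<^esub> t"
        using 1(1) w Cons by auto
      then have "u = gen i [^]\<^bsub>free_group S\<^esub> (s + t)"
        unfolding u s using g by (simp add: int_pow_mult)
      then show ?thesis by blast
    next
      case False
      have pre: "foldr red_cons (replicate j (i, True)) u = replicate j (i, True) @ u" for j
      proof (induction j)
        case (Suc j)
        then show ?case using Cons False by (cases j) (auto simp: inv_letter_def)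
      qed simp
      then have eq: "replicate k (i, True) @ u = foldr red_cons u (replicate k (i, True))"
        using 1(3) by (simp add: gen_nat_pow) (simp add: free_group_def)
      then have "length (foldr red_cons u (replicate k (i, True))) = length u + length (replicate k (i, True))"
        by (metis add.commute length_append)
      from foldr_red_cons_append[OF this] eq have "replicate k (i, True) @ u = u @ replicate k (i, True)"
        by simp
      then have "hd (replicate k (i, True) @ u) = hd (u @ replicate k (i, True))" by simp
      then show ?thesis using False Cons k by auto
    qed
  qed
qed

text \<open>Otherwise the simplifier rewrites the index set \<open>{1..n}\<close> of \<open>FF n\<close> to \<open>{Suc 0..n}\<close>, and the
  interpreted group laws no longer match.\<close>

declare One_nat_def [simp del]

lemma Hsub_range: "Hsub n i = range (\<lambda>s::int. gen i [^]\<^bsub>FF n\<^esub> s)"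
  by (auto simp: Hsub_def)

text \<open>Exponent sums are invariant under conjugation. They force equal generators and then
  equal exponents, so \<open>u\<close> commutes with the \<open>k\<close>-th power of
  \<open>gen i\<close> and lies in its centraliser.\<close>

lemma conj_gen_pow_in_Hsub:
  assumes i: "i \<in> {1..n}" "i' \<in> {1..n}" and k: "k > (0::nat)" and u: "u \<in> carrier (FF n)"
    and conj: "inv\<^bsub>FF n\<^esub> u \<otimes>\<^bsub>FF n\<^esub> (gen i [^]\<^bsub>FF n\<^esub> k \<otimes>\<^bsub>FF n\<^esub> u) \<in> Hsub n i'"
  shows "i = i'" "u \<in> Hsub n i"
proof -
  interpret group "FF n" by (rule group_free_group)
  have g: "gen i \<in> carrier (FF n)" "gen i' \<in> carrier (FF n)"
    using i by (simp_all add: gen_in_free_group)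
  obtain s :: int where s: "inv\<^bsub>FF n\<^esub> u \<otimes>\<^bsub>FF n\<^esub> (gen i [^]\<^bsub>FF n\<^esub> k \<otimes>\<^bsub>FF n\<^esub> u) = gen i' [^]\<^bsub>FF n\<^esub> s"
    using conj by (auto simp: Hsub_def)
  have w: "int k * c i = s * c i'" for c
    using arg_cong[OF s, of "weight c"] weight_int_pow[OF g(1), of c "int k"] weight_int_pow[OF g(2), of c s]
    by (simp add: weight_mult weight_inv[OF u] int_pow_int)
  show ii: "i = i'"
    \<comment> \<open>The weight counting only \<open>i\<close> has value \<open>k > 0\<close> on
      the left, so it cannot vanish at \<open>i'\<close>.\<close>
    using w[of "\<lambda>j. if j = i then 1 else 0"] k by (auto split: if_splits)
  have "s = int k" using w[of "\<lambda>_. 1"] by simp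
  then have "inv\<^bsub>FF n\<^esub> u \<otimes>\<^bsub>FF n\<^esub> (gen i [^]\<^bsub>FF n\<^esub> k \<otimes>\<^bsub>FF n\<^esub> u) = gen i [^]\<^bsub>FF n\<^esub> k"
    using s ii by (simp add: int_pow_int)
  then have "gen i [^]\<^bsub>FF n\<^esub> k \<otimes>\<^bsub>FF n\<^esub> u = u \<otimes>\<^bsub>FF n\<^esub> gen i [^]\<^bsub>FF n\<^esub> k"
    using u g inv_solve_left[of "gen i [^]\<^bsub>FF n\<^esub> k" u "gen i [^]\<^bsub>FF n\<^esub> k \<otimes>\<^bsub>FF n\<^esub> u"] by simp
  then show "u \<in> Hsub n i" unfolding Hsub_range by (rule commutes_gen_pow[OF i(1) k u])
qed

section \<open>The homomorphism \<open>phi\<close> and membership in \<open>Ksub\<close>\<close>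

context
  fixes n m :: nat
begin

interpretation group_hom "FF (n * m)" "FF n \<times>\<times> FF m" "phi n m"
  by (intro group_hom.intro group_hom_axioms.intro group_free_group DirProd_group phi_hom)
interpretation Fn: group "FF n" by (rule group_free_group)
interpretation Fm: group "FF m" by (rule group_free_group)

lemma fst_phi_hom: "(\<lambda>x. fst (phi n m x)) \<in> hom (FF (n * m)) (FF n)"
proof (rule homI)
  fix x y assume xy: "x \<in> carrier (FF (n * m))" "y \<in> carrier (FF (n * m))"
  show "fst (phi n m x) \<in> carrier (FF n)" using hom_closed[OF xy(1)] by (auto simp: DirProd_def)
  show "fst (phi n m (x \<otimes>\<^bsub>FF (n * m)\<^esub> y)) = fst (phi n m x) \<otimes>\<^bsub>FF n\<^esub> fst (phi n m y)"
    using xy by (cases "phi n m x"; cases "phi n m y") simp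
qed

lemma snd_phi_hom: "(\<lambda>x. snd (phi n m x)) \<in> hom (FF (n * m)) (FF m)"
proof (rule homI)
  fix x y assume xy: "x \<in> carrier (FF (n * m))" "y \<in> carrier (FF (n * m))"
  show "snd (phi n m x) \<in> carrier (FF m)" using hom_closed[OF xy(1)] by (auto simp: DirProd_def)
  show "snd (phi n m (x \<otimes>\<^bsub>FF (n * m)\<^esub> y)) = snd (phi n m x) \<otimes>\<^bsub>FF m\<^esub> snd (phi n m y)"
    using xy by (cases "phi n m x"; cases "phi n m y") simp
qed

lemma index_cases:
  assumes "l \<in> {1..n * m}"
  obtains i j where "i \<in> {1..n}" "j \<in> {1..m}" "l = m * (i - 1) + j"
proof
  show "(l - 1) div m + 1 \<in> {1..n}" "(l - 1) mod m + 1 \<in> {1..m}" by (rule phi_index[OF assms])+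
  show "l = m * ((l - 1) div m + 1 - 1) + ((l - 1) mod m + 1)"
    using assms by simp
qed

text \<open>Each generator maps to a pair of generators, so both exponent sums are 1 on generators
  and the two homomorphisms to the integers agree. \<open>Ksub_iff\<close> rests on this constraint
  on the image of \<open>phi\<close>.\<close>

lemma weight_phi:
  assumes x: "x \<in> carrier (FF (n * m))"
  shows "weight (\<lambda>_. 1) (fst (phi n m x)) = weight (\<lambda>_. 1) (snd (phi n m x))"
proof (rule free_group_hom_eqI[OF group_integer_group _ _ _ x])
  show "(\<lambda>x. weight (\<lambda>_. 1) (fst (phi n m x))) \<in> hom (FF (n * m)) integer_group"
    using Group.hom_compose[OF fst_phi_hom weight_hom] by (simp add: comp_def)
  show "(\<lambda>x. weight (\<lambda>_. 1) (snd (phi n m x))) \<in> hom (FF (n * m)) integer_group"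
    using Group.hom_compose[OF snd_phi_hom weight_hom] by (simp add: comp_def)
  fix l assume "l \<in> {1..n * m}"
  then obtain i j where "i \<in> {1..n}" "j \<in> {1..m}" "l = m * (i - 1) + j" by (rule index_cases)
  then show "weight (\<lambda>_. 1) (fst (phi n m (gen l))) = weight (\<lambda>_. 1) (snd (phi n m (gen l)))"
    using phi_gen(2) by simp
qed

lemma phi_gen_pow:
  assumes ij: "i \<in> {1..n}" "j \<in> {1..m}"
  shows "phi n m (gen (m * (i - 1) + j) [^]\<^bsub>FF (n * m)\<^esub> (s::int)) = (gen i [^]\<^bsub>FF n\<^esub> s, gen j [^]\<^bsub>FF m\<^esub> s)"
proof -
  have g: "gen (m * (i - 1) + j) \<in> carrier (FF (n * m))"
    using phi_gen(1)[OF ij] by (rule gen_in_free_group)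
  interpret f: group_hom "FF (n * m)" "FF n" "\<lambda>x. fst (phi n m x)"
    by (intro group_hom.intro group_hom_axioms.intro group_free_group fst_phi_hom)
  interpret s: group_hom "FF (n * m)" "FF m" "\<lambda>x. snd (phi n m x)"
    by (intro group_hom.intro group_hom_axioms.intro group_free_group snd_phi_hom)
  show ?thesis
    using f.hom_int_pow[OF g, of s] s.hom_int_pow[OF g, of s] phi_gen(2)[OF ij]
    by (simp add: prod_eq_iff)
qed

text \<open>If \<open>phi\<close> sends \<open>x\<close> to powers of \<open>gen i\<close> and
  \<open>gen j\<close>, the exponents coincide by \<open>weight_phi\<close>. The same power of the
  generator with index \<open>m * (i - 1) + j\<close> then has the same image, and \<open>x\<close>
  differs from it by an element of the kernel.\<close>

lemma Ksub_iff:
  assumes ij: "i \<in> {1..n}" "j \<in> {1..m}"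
  shows "x \<in> Ksub n m (m * (i - 1) + j) \<longleftrightarrow>
    x \<in> carrier (FF (n * m)) \<and> fst (phi n m x) \<in> Hsub n i \<and> snd (phi n m x) \<in> Hsub m j"
proof -
  let ?l = "m * (i - 1) + j"
  have g: "gen ?l \<in> carrier (FF (n * m))" using phi_gen(1)[OF ij] by (rule gen_in_free_group)
  have gi: "gen i \<in> carrier (FF n)" "gen j \<in> carrier (FF m)" using ij by (simp_all add: gen_in_free_group)
  show ?thesis
  proof (intro iffI conjI)
    assume x: "x \<in> Ksub n m ?l"
    then obtain y and s :: int where y: "y \<in> carrier (FF (n * m))" "phi n m y = \<one>\<^bsub>FF n \<times>\<times> FF m\<^esub>"
      and xy: "x = y \<otimes>\<^bsub>FF (n * m)\<^esub> gen ?l [^]\<^bsub>FF (n * m)\<^esub> s"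
      by (auto simp: Ksub_def set_mult_def Gker_def kernel_def Hsub_def)
    show "x \<in> carrier (FF (n * m))" using y g xy by simp
    have "phi n m x = (gen i [^]\<^bsub>FF n\<^esub> s, gen j [^]\<^bsub>FF m\<^esub> s)"
      using y g gi by (simp add: xy phi_gen_pow[OF ij])
    then show "fst (phi n m x) \<in> Hsub n i" "snd (phi n m x) \<in> Hsub m j" by (auto simp: Hsub_def)
  next
    assume x: "x \<in> carrier (FF (n * m)) \<and> fst (phi n m x) \<in> Hsub n i \<and> snd (phi n m x) \<in> Hsub m j"
    then obtain s t :: int where st: "phi n m x = (gen i [^]\<^bsub>FF n\<^esub> s, gen j [^]\<^bsub>FF m\<^esub> t)"
      by (auto simp: Hsub_def prod_eq_iff)
    have "s = t" using weight_phi[of x] x by (simp add: st weight_int_pow[OF gi(1)] weight_int_pow[OF gi(2)])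
    let ?p = "gen ?l [^]\<^bsub>FF (n * m)\<^esub> s"
    let ?y = "x \<otimes>\<^bsub>FF (n * m)\<^esub> inv\<^bsub>FF (n * m)\<^esub> ?p"
    have "phi n m ?y = phi n m x \<otimes>\<^bsub>FF n \<times>\<times> FF m\<^esub> inv\<^bsub>FF n \<times>\<times> FF m\<^esub> phi n m x"
      using x g st \<open>s = t\<close> by (simp add: phi_gen_pow[OF ij])
    also have "\<dots> = \<one>\<^bsub>FF n \<times>\<times> FF m\<^esub>" using x hom_closed by (intro H.r_inv) blast
    finally have "?y \<in> Gker n m" using x g by (simp add: Gker_def kernel_def)
    moreover have "?y \<otimes>\<^bsub>FF (n * m)\<^esub> ?p = x" using x g by (simp add: G.m_assoc)
    moreover have "?p \<in> Hsub (n * m) ?l" by (auto simp: Hsub_def)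
    ultimately show "x \<in> Ksub n m ?l" unfolding Ksub_def set_mult_def by blast
  qed
qed

text \<open>Both coordinates of \<open>phi\<close> turn the hypothesis into an instance of
  \<open>conj_gen_pow_in_Hsub\<close>, and a pair of indices determines \<open>l\<close>. The two
  conclusions supply the \<open>sep\<close> hypotheses for inequivalence and irreducibility.\<close>

lemma conj_gen_pow_in_Ksub:
  assumes l: "l \<in> {1..n * m}" "l' \<in> {1..n * m}" and k: "k > (0::nat)" and x: "x \<in> carrier (FF (n * m))"
    and conj: "inv\<^bsub>FF (n * m)\<^esub> x \<otimes>\<^bsub>FF (n * m)\<^esub> (gen l [^]\<^bsub>FF (n * m)\<^esub> k \<otimes>\<^bsub>FF (n * m)\<^esub> x) \<in> Ksub n m l'"
  shows "l = l'" "x \<in> Ksub n m l"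
proof -
  obtain i j where ij: "i \<in> {1..n}" "j \<in> {1..m}" "l = m * (i - 1) + j" using l(1) by (rule index_cases)
  obtain i' j' where ij': "i' \<in> {1..n}" "j' \<in> {1..m}" "l' = m * (i' - 1) + j'" using l(2) by (rule index_cases)
  interpret f: group_hom "FF (n * m)" "FF n" "\<lambda>x. fst (phi n m x)"
    by (intro group_hom.intro group_hom_axioms.intro group_free_group fst_phi_hom)
  interpret s: group_hom "FF (n * m)" "FF m" "\<lambda>x. snd (phi n m x)"
    by (intro group_hom.intro group_hom_axioms.intro group_free_group snd_phi_hom)
  have g: "gen l \<in> carrier (FF (n * m))" using l(1) by (rule gen_in_free_group)
  have pg: "fst (phi n m (gen l)) = gen i" "snd (phi n m (gen l)) = gen j"
    using phi_gen(2)[OF ij(1,2)] ij(3) by simp_all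
  have *: "inv\<^bsub>FF n\<^esub> fst (phi n m x) \<otimes>\<^bsub>FF n\<^esub> (gen i [^]\<^bsub>FF n\<^esub> k \<otimes>\<^bsub>FF n\<^esub> fst (phi n m x)) \<in> Hsub n i'"
    "inv\<^bsub>FF m\<^esub> snd (phi n m x) \<otimes>\<^bsub>FF m\<^esub> (gen j [^]\<^bsub>FF m\<^esub> k \<otimes>\<^bsub>FF m\<^esub> snd (phi n m x)) \<in> Hsub m j'"
    using conj x g unfolding ij'(3) Ksub_iff[OF ij'(1,2)]
    by (simp_all only: f.hom_mult f.hom_inv f.hom_nat_pow s.hom_mult s.hom_inv s.hom_nat_pow pg
        G.inv_closed G.m_closed G.nat_pow_closed)
  note 1 = conj_gen_pow_in_Hsub[OF ij(1) ij'(1) k f.hom_closed[OF x] *(1)]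
  note 2 = conj_gen_pow_in_Hsub[OF ij(2) ij'(2) k s.hom_closed[OF x] *(2)]
  show "l = l'" using 1(1) 2(1) ij(3) ij'(3) by simp
  show "x \<in> Ksub n m l" unfolding ij(3) Ksub_iff[OF ij(1,2)] using x 1(2) 2(2) by simp
qed

text \<open>Lifting \<open>g\<^sub>a \<mapsto> g\<^bsub>(a,j)\<^esub>\<close> to a homomorphism gives an \<open>x\<close> over \<open>(u, g\<^sub>j\<^sup>s)\<close>, and
  \<open>g\<^sub>b \<mapsto> g\<^bsub>(i,b)\<^esub>\<close> then gives a \<open>y\<close> over \<open>(g\<^sub>i\<^sup>t, g\<^sub>j\<^sup>-\<^sup>s v)\<close>.\<close>

lemma phi_transitive:
  assumes ij: "i \<in> {1..n}" "j \<in> {1..m}" and u: "u \<in> carrier (FF n)" and v: "v \<in> carrier (FF m)"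
  shows "\<exists>x\<in>carrier (FF (n * m)). \<exists>t::int. phi n m x = (u \<otimes>\<^bsub>FF n\<^esub> gen i [^]\<^bsub>FF n\<^esub> t, v)"
proof -
  have gi: "gen i \<in> carrier (FF n)" "gen j \<in> carrier (FF m)" using ij by (simp_all add: gen_in_free_group)
  \<comment> \<open>This homomorphism sends every generator of \<open>FF p\<close> to
    \<open>gen a\<close>. It describes the second coordinate of \<open>phi\<close> after
    \<open>L\<close> and the first coordinate after \<open>M\<close>.\<close>
  have pow_hom: "(\<lambda>w. gen a [^]\<^bsub>FF q\<^esub> weight (\<lambda>_. 1) w) \<in> hom (FF p) (FF q)" if "a \<in> {1..q}" for a p q
  proof -
    interpret Fq: group "FF q" by (rule group_free_group)
    have "gen a \<in> carrier (FF q)" using that by (rule gen_in_free_group)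
    then show ?thesis by (intro homI) (simp_all add: weight_mult Fq.int_pow_mult)
  qed
  have id_hom: "(\<lambda>w. w) \<in> hom (FF p) (FF p)" for p by (rule homI) auto
  define L where "L = free_lift (FF (n * m)) (\<lambda>a. gen (m * (a - 1) + j))"
  define M where "M = free_lift (FF (n * m)) (\<lambda>b. gen (m * (i - 1) + b))"
  have L: "L \<in> hom (FF n) (FF (n * m))"
    unfolding L_def using ij by (intro free_lift_hom group_free_group gen_in_free_group phi_gen(1))
  have M: "M \<in> hom (FF m) (FF (n * m))"
    unfolding M_def using ij by (intro free_lift_hom group_free_group gen_in_free_group phi_gen(1))
  have L_gen: "phi n m (L (gen a)) = (gen a, gen j)" if "a \<in> {1..n}" for a
    using phi_gen(2)[OF that ij(2)] gen_in_free_group[OF phi_gen(1)[OF that ij(2)]]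
    by (simp add: L_def free_lift_gen[OF group_free_group])
  have M_gen: "phi n m (M (gen b)) = (gen i, gen b)" if "b \<in> {1..m}" for b
    using phi_gen(2)[OF ij(1) that] gen_in_free_group[OF phi_gen(1)[OF ij(1) that]]
    by (simp add: M_def free_lift_gen[OF group_free_group])
  have L1: "fst (phi n m (L w)) = w" if "w \<in> carrier (FF n)" for w
    by (rule free_group_hom_eqI[OF group_free_group _ id_hom _ that])
      (use Group.hom_compose[OF L fst_phi_hom] L_gen in \<open>auto simp: comp_def\<close>)
  have L2: "snd (phi n m (L w)) = gen j [^]\<^bsub>FF m\<^esub> weight (\<lambda>_. 1) w" if "w \<in> carrier (FF n)" for w
    by (rule free_group_hom_eqI[OF group_free_group _ pow_hom[OF ij(2)] _ that])
      (use Group.hom_compose[OF L snd_phi_hom] L_gen gi in \<open>auto simp: comp_def\<close>)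
  have M1: "fst (phi n m (M w)) = gen i [^]\<^bsub>FF n\<^esub> weight (\<lambda>_. 1) w" if "w \<in> carrier (FF m)" for w
    by (rule free_group_hom_eqI[OF group_free_group _ pow_hom[OF ij(1)] _ that])
      (use Group.hom_compose[OF M fst_phi_hom] M_gen gi in \<open>auto simp: comp_def\<close>)
  have M2: "snd (phi n m (M w)) = w" if "w \<in> carrier (FF m)" for w
    by (rule free_group_hom_eqI[OF group_free_group _ id_hom _ that])
      (use Group.hom_compose[OF M snd_phi_hom] M_gen in \<open>auto simp: comp_def\<close>)
  define x where "x = L u"
  \<comment> \<open>The argument of \<open>M\<close> corrects the second coordinate of
    \<open>x\<close> to \<open>v\<close>, while the first coordinate changes only by a power of
    \<open>gen i\<close>.\<close>
  define y where "y = M (inv\<^bsub>FF m\<^esub> snd (phi n m x) \<otimes>\<^bsub>FF m\<^esub> v)"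
  have x: "x \<in> carrier (FF (n * m))" unfolding x_def using L u by (rule hom_in_carrier)
  have px: "snd (phi n m x) \<in> carrier (FF m)" using snd_phi_hom x by (rule hom_in_carrier)
  then have pv: "inv\<^bsub>FF m\<^esub> snd (phi n m x) \<otimes>\<^bsub>FF m\<^esub> v \<in> carrier (FF m)" using v by simp
  have y: "y \<in> carrier (FF (n * m))" unfolding y_def using M pv by (rule hom_in_carrier)
  have "fst (phi n m (x \<otimes>\<^bsub>FF (n * m)\<^esub> y)) =
      u \<otimes>\<^bsub>FF n\<^esub> gen i [^]\<^bsub>FF n\<^esub> weight (\<lambda>_. 1) (inv\<^bsub>FF m\<^esub> snd (phi n m x) \<otimes>\<^bsub>FF m\<^esub> v)"
    using Group.hom_mult[OF fst_phi_hom x y] L1[OF u] M1[OF pv] by (simp add: x_def y_def)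
  moreover have "snd (phi n m (x \<otimes>\<^bsub>FF (n * m)\<^esub> y)) = v"
    using Group.hom_mult[OF snd_phi_hom x y] M2[OF pv] px v by (simp add: y_def flip: Fm.m_assoc)
  ultimately show ?thesis using G.m_closed[OF x y]
    by (intro bexI[where x = "x \<otimes>\<^bsub>FF (n * m)\<^esub> y"] exI) (simp_all add: prod_eq_iff)
qed

end

section \<open>Cosets of \<open>Ksub\<close> as pairs of cosets, and the tensor product\<close>

text \<open>Taking images of the whole coset avoids choosing a representative;
  \<open>phi_coset\<close> shows that the images are again cosets.\<close>

definition coset_pair :: "nat \<Rightarrow> nat \<Rightarrow> nat word set \<Rightarrow> nat word set \<times> nat word set" where
  "coset_pair n m C = (fst ` phi n m ` C, snd ` phi n m ` C)"

context
  fixes n m i j l :: nat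
  assumes ij: "i \<in> {1..n}" "j \<in> {1..m}" and l: "l = m * (i - 1) + j"
begin

interpretation G: group "FF (n * m)" by (rule group_free_group)
interpretation f: group_hom "FF (n * m)" "FF n" "\<lambda>x. fst (phi n m x)"
  by (intro group_hom.intro group_hom_axioms.intro group_free_group fst_phi_hom)
interpretation s: group_hom "FF (n * m)" "FF m" "\<lambda>x. snd (phi n m x)"
  by (intro group_hom.intro group_hom_axioms.intro group_free_group snd_phi_hom)

lemma Ksub_iff_l:
  "x \<in> Ksub n m l \<longleftrightarrow>
    x \<in> carrier (FF (n * m)) \<and> fst (phi n m x) \<in> Hsub n i \<and> snd (phi n m x) \<in> Hsub m j"
  unfolding l by (rule Ksub_iff[OF ij])

lemma subgroup_Ksub_l: "subgroup (Ksub n m l) (FF (n * m))"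
  unfolding l using phi_gen(1)[OF ij] by (rule subgroup_Ksub)

lemma gen_pow_in_Ksub: "gen l [^]\<^bsub>FF (n * m)\<^esub> (t::int) \<in> Ksub n m l"
  unfolding Ksub_iff_l using gen_in_free_group[OF phi_gen(1)[OF ij], folded l]
  by (auto simp: phi_gen_pow[OF ij, folded l] Hsub_def)

text \<open>\<open>Ksub n m l\<close> projects onto all of \<open>Hsub n i\<close> and all of
  \<open>Hsub m j\<close>, because the powers of \<open>gen l\<close> already do.\<close>

lemma phi_coset:
  assumes x: "x \<in> carrier (FF (n * m))"
  shows "fst ` phi n m ` (x <#\<^bsub>FF (n * m)\<^esub> Ksub n m l) = fst (phi n m x) <#\<^bsub>FF n\<^esub> Hsub n i"
    "snd ` phi n m ` (x <#\<^bsub>FF (n * m)\<^esub> Ksub n m l) = snd (phi n m x) <#\<^bsub>FF m\<^esub> Hsub m j"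
proof -
  let ?g = "gen l"
  have K: "k \<in> carrier (FF (n * m))" "fst (phi n m k) \<in> Hsub n i" "snd (phi n m k) \<in> Hsub m j"
    if "k \<in> Ksub n m l" for k using that by (simp_all add: Ksub_iff_l)
  have xg: "x \<otimes>\<^bsub>FF (n * m)\<^esub> ?g [^]\<^bsub>FF (n * m)\<^esub> t \<in> x <#\<^bsub>FF (n * m)\<^esub> Ksub n m l" for t :: int
    using gen_pow_in_Ksub by (auto simp: l_coset_def)
  have g: "?g [^]\<^bsub>FF (n * m)\<^esub> t \<in> carrier (FF (n * m))" for t :: int
    by (rule K(1)[OF gen_pow_in_Ksub])
  show "fst ` phi n m ` (x <#\<^bsub>FF (n * m)\<^esub> Ksub n m l) = fst (phi n m x) <#\<^bsub>FF n\<^esub> Hsub n i"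
  proof (intro subset_antisym subsetI)
    fix u assume "u \<in> fst ` phi n m ` (x <#\<^bsub>FF (n * m)\<^esub> Ksub n m l)"
    then show "u \<in> fst (phi n m x) <#\<^bsub>FF n\<^esub> Hsub n i"
      using x K(1,2) by (auto simp: l_coset_def f.hom_mult)
  next
    fix u assume "u \<in> fst (phi n m x) <#\<^bsub>FF n\<^esub> Hsub n i"
    then obtain t :: int where "u = fst (phi n m x) \<otimes>\<^bsub>FF n\<^esub> gen i [^]\<^bsub>FF n\<^esub> t"
      by (auto simp: l_coset_def Hsub_def)
    then have "u = fst (phi n m (x \<otimes>\<^bsub>FF (n * m)\<^esub> ?g [^]\<^bsub>FF (n * m)\<^esub> t))"
      using f.hom_mult[OF x g, of t] by (simp add: phi_gen_pow[OF ij, folded l])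
    then show "u \<in> fst ` phi n m ` (x <#\<^bsub>FF (n * m)\<^esub> Ksub n m l)" using xg[of t] by blast
  qed
  show "snd ` phi n m ` (x <#\<^bsub>FF (n * m)\<^esub> Ksub n m l) = snd (phi n m x) <#\<^bsub>FF m\<^esub> Hsub m j"
  proof (intro subset_antisym subsetI)
    fix u assume "u \<in> snd ` phi n m ` (x <#\<^bsub>FF (n * m)\<^esub> Ksub n m l)"
    then show "u \<in> snd (phi n m x) <#\<^bsub>FF m\<^esub> Hsub m j"
      using x K(1,3) by (auto simp: l_coset_def s.hom_mult)
  next
    fix u assume "u \<in> snd (phi n m x) <#\<^bsub>FF m\<^esub> Hsub m j"
    then obtain t :: int where "u = snd (phi n m x) \<otimes>\<^bsub>FF m\<^esub> gen j [^]\<^bsub>FF m\<^esub> t"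
      by (auto simp: l_coset_def Hsub_def)
    then have "u = snd (phi n m (x \<otimes>\<^bsub>FF (n * m)\<^esub> ?g [^]\<^bsub>FF (n * m)\<^esub> t))"
      using s.hom_mult[OF x g, of t] by (simp add: phi_gen_pow[OF ij, folded l])
    then show "u \<in> snd ` phi n m ` (x <#\<^bsub>FF (n * m)\<^esub> Ksub n m l)" using xg[of t] by blast
  qed
qed

lemma coset_pair_eq:
  "x \<in> carrier (FF (n * m)) \<Longrightarrow> coset_pair n m (x <#\<^bsub>FF (n * m)\<^esub> Ksub n m l) =
    (fst (phi n m x) <#\<^bsub>FF n\<^esub> Hsub n i, snd (phi n m x) <#\<^bsub>FF m\<^esub> Hsub m j)"
  by (simp add: coset_pair_def phi_coset)

text \<open>Injectivity holds because \<open>Ksub n m l\<close> is the full preimage of the product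
  of the two subgroups under \<open>phi\<close>; surjectivity is
  \<open>phi_transitive\<close>.\<close>

lemma bij_coset_pair:
  "bij_betw (coset_pair n m) (lcosets\<^bsub>FF (n * m)\<^esub> Ksub n m l) ((lcosets\<^bsub>FF n\<^esub> Hsub n i) \<times> (lcosets\<^bsub>FF m\<^esub> Hsub m j))"
  unfolding bij_betw_def
proof
  note GH = group_free_group subgroup_Hsub[OF ij(1)] and GH' = group_free_group subgroup_Hsub[OF ij(2)]
    and GK = group_free_group subgroup_Ksub_l
  show "inj_on (coset_pair n m) (lcosets\<^bsub>FF (n * m)\<^esub> Ksub n m l)"
  proof (rule inj_onI)
    fix C D assume "C \<in> lcosets\<^bsub>FF (n * m)\<^esub> Ksub n m l" "D \<in> lcosets\<^bsub>FF (n * m)\<^esub> Ksub n m l" and eq: "coset_pair n m C = coset_pair n m D"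
    then obtain x y where x: "x \<in> carrier (FF (n * m))" "C = x <#\<^bsub>FF (n * m)\<^esub> Ksub n m l"
      and y: "y \<in> carrier (FF (n * m))" "D = y <#\<^bsub>FF (n * m)\<^esub> Ksub n m l"
      by (auto simp: LCOSETS_def)
    have "inv\<^bsub>FF (n * m)\<^esub> x \<otimes>\<^bsub>FF (n * m)\<^esub> y \<in> Ksub n m l"
      using eq x y unfolding Ksub_iff_l
      by (simp add: coset_pair_eq lcoset_eq_iff[OF GH] lcoset_eq_iff[OF GH'])
    then show "C = D" using x y by (simp add: lcoset_eq_iff[OF GK])
  qed
  show "coset_pair n m ` (lcosets\<^bsub>FF (n * m)\<^esub> Ksub n m l) =
      (lcosets\<^bsub>FF n\<^esub> Hsub n i) \<times> (lcosets\<^bsub>FF m\<^esub> Hsub m j)"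
  proof (intro subset_antisym subsetI)
    fix P assume "P \<in> coset_pair n m ` (lcosets\<^bsub>FF (n * m)\<^esub> Ksub n m l)"
    then obtain x where "x \<in> carrier (FF (n * m))"
      "P = (fst (phi n m x) <#\<^bsub>FF n\<^esub> Hsub n i, snd (phi n m x) <#\<^bsub>FF m\<^esub> Hsub m j)"
      by (auto simp: LCOSETS_def coset_pair_eq)
    then show "P \<in> (lcosets\<^bsub>FF n\<^esub> Hsub n i) \<times> (lcosets\<^bsub>FF m\<^esub> Hsub m j)"
      by (simp add: lcoset_closed[OF GH] lcoset_closed[OF GH'])
  next
    fix P assume "P \<in> (lcosets\<^bsub>FF n\<^esub> Hsub n i) \<times> (lcosets\<^bsub>FF m\<^esub> Hsub m j)"
    then obtain u v where u: "u \<in> carrier (FF n)" and v: "v \<in> carrier (FF m)"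
      and P: "P = (u <#\<^bsub>FF n\<^esub> Hsub n i, v <#\<^bsub>FF m\<^esub> Hsub m j)"
      by (auto simp: LCOSETS_def)
    obtain x and t :: int where x: "x \<in> carrier (FF (n * m))"
      and px: "phi n m x = (u \<otimes>\<^bsub>FF n\<^esub> gen i [^]\<^bsub>FF n\<^esub> t, v)"
      using phi_transitive[OF ij u v] by blast
    have gi: "gen i \<in> carrier (FF n)" using ij(1) by (rule gen_in_free_group)
    \<comment> \<open>The extra power of \<open>gen i\<close> from \<open>phi_transitive\<close> is
      absorbed by the coset of \<open>Hsub n i\<close>.\<close>
    have "inv\<^bsub>FF n\<^esub> u \<otimes>\<^bsub>FF n\<^esub> (u \<otimes>\<^bsub>FF n\<^esub> gen i [^]\<^bsub>FF n\<^esub> t) \<in> Hsub n i"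
      using u gi by (auto simp: Hsub_def simp flip: f.H.m_assoc)
    then have "u <#\<^bsub>FF n\<^esub> Hsub n i = (u \<otimes>\<^bsub>FF n\<^esub> gen i [^]\<^bsub>FF n\<^esub> t) <#\<^bsub>FF n\<^esub> Hsub n i"
      using u gi by (simp add: lcoset_eq_iff[OF GH])
    then have "P = coset_pair n m (x <#\<^bsub>FF (n * m)\<^esub> Ksub n m l)" using x px P by (simp add: coset_pair_eq)
    then show "P \<in> coset_pair n m ` (lcosets\<^bsub>FF (n * m)\<^esub> Ksub n m l)"
      using x by (auto simp: LCOSETS_def)
  qed
qed

lemma coset_pair_move:
  assumes g: "g \<in> carrier (FF (n * m))" and C: "C \<in> lcosets\<^bsub>FF (n * m)\<^esub> Ksub n m l"
  shows "coset_pair n m (g <#\<^bsub>FF (n * m)\<^esub> C) =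
    (fst (phi n m g) <#\<^bsub>FF n\<^esub> fst (coset_pair n m C), snd (phi n m g) <#\<^bsub>FF m\<^esub> snd (coset_pair n m C))"
proof -
  obtain x where x: "x \<in> carrier (FF (n * m))" "C = x <#\<^bsub>FF (n * m)\<^esub> Ksub n m l" using C by (auto simp: LCOSETS_def)
  then show ?thesis
    using g by (simp add: coset_pair_eq l_coset_mult[OF group_free_group subgroup_Ksub_l]
        l_coset_mult[OF group_free_group subgroup_Hsub[OF ij(1)]]
        l_coset_mult[OF group_free_group subgroup_Hsub[OF ij(2)]])
qed

text \<open>Under \<open>coset_pair\<close>, translation by \<open>g\<close> is simultaneous
  translation by the two components of \<open>phi n m g\<close>. The tensor product of the two
  translation operators therefore becomes the translation operator on
  \<open>ell2 ?Z\<close>.\<close>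

lemma tensor_quasi_regular_equivalent:
  "unitarily_equivalent (FF (n * m))
    (tensor_phi n m (quasi_regular (FF n) (Hsub n i)) (quasi_regular (FF m) (Hsub m j)))
    (quasi_regular (FF (n * m)) (Ksub n m l))"
proof -
  let ?X = "lcosets\<^bsub>FF n\<^esub> Hsub n i" and ?Y = "lcosets\<^bsub>FF m\<^esub> Hsub m j" and ?Z = "lcosets\<^bsub>FF (n * m)\<^esub> Ksub n m l"
  let ?W = "alg_tensor (ell2 ?X) (ell2 ?Y)"
  let ?T = "tensor_eval ?Z (coset_pair n m)"
  let ?A = "approx_seqs ?W ?Z ?T"
  note GH = group_free_group subgroup_Hsub[OF ij(1)] and GH' = group_free_group subgroup_Hsub[OF ij(2)]
    and GK = group_free_group subgroup_Ksub_l
  have A: "unitary_map (ell2 ?Z) (hilbert_tensor (ell2 ?X) (ell2 ?Y)) ?A"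
    using bij_coset_pair by (rule tensor_unitary)
  have img: "?A ` carrier (ell2 ?Z) = carrier (hilbert_tensor (ell2 ?X) (ell2 ?Y))"
    and inj: "inj_on ?A (carrier (ell2 ?Z))"
    using A by (auto simp: unitary_map_def bij_betw_def)
  let ?U = "inv_into (carrier (ell2 ?Z)) ?A"
  have U: "unitary_map (hilbert_tensor (ell2 ?X) (ell2 ?Y)) (ell2 ?Z) ?U"
    using A by (rule unitary_map_inv_into) (simp_all add: ell2_simps(1,3) l2norm_add ell2_scale)
  have "?U (ract (tensor_phi n m (quasi_regular (FF n) (Hsub n i)) (quasi_regular (FF m) (Hsub m j))) g v) =
      ract (quasi_regular (FF (n * m)) (Ksub n m l)) g (?U v)"
    if g: "g \<in> carrier (FF (n * m))" and v: "v \<in> carrier (hilbert_tensor (ell2 ?X) (ell2 ?Y))" for g v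
  proof -
    let ?S = "ract (quasi_regular (FF n) (Hsub n i)) (fst (phi n m g))"
    let ?R = "ract (quasi_regular (FF m) (Hsub m j)) (snd (phi n m g))"
    let ?L = "ract (quasi_regular (FF (n * m)) (Ksub n m l)) g"
    obtain e where e: "e \<in> carrier (ell2 ?Z)" "v = ?A e" using v img by blast
    note closed = quasi_regular_closed(1)[OF GK g]
    have move: "tensor_fun ?Z (coset_pair n m) (?S f, ?R h) C = (if C \<in> ?Z
        then tensor_fun ?Z (coset_pair n m) (f, h) (inv\<^bsub>FF (n * m)\<^esub> g <#\<^bsub>FF (n * m)\<^esub> C) else 0)" for f h C
    proof (cases "C \<in> ?Z")
      case True
      have "coset_pair n m C \<in> ?X \<times> ?Y" using bij_coset_pair True by (auto simp: bij_betw_def)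
      then show ?thesis
        using True lcoset_move[OF GK G.inv_closed[OF g] True] coset_pair_move[OF G.inv_closed[OF g] True] g
        by (auto simp: tensor_fun_def quasi_regular_apply[OF GH] quasi_regular_apply[OF GH'])
    qed (simp add: tensor_fun_def)
    have "tensor_map (ell2 ?X) (ell2 ?Y) ?S ?R (?A e) = ?A (?L e)"
    proof (rule tensor_unitary(2)[OF bij_coset_pair])
      show "?S f \<in> carrier (ell2 ?X)" if "f \<in> carrier (ell2 ?X)" for f
        using that by (intro quasi_regular_closed[OF GH] f.hom_closed g)
      show "?R f \<in> carrier (ell2 ?Y)" if "f \<in> carrier (ell2 ?Y)" for f
        using that by (intro quasi_regular_closed[OF GH'] s.hom_closed g)
      show "?T (alg_tensor_map ?S ?R a) = ?L (?T a)" for a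
      proof
        fix C
        show "?T (alg_tensor_map ?S ?R a) C = ?L (?T a) C"
          by (simp add: alg_tensor_map_def tensor_eval_sum tensor_eval_single move
              quasi_regular_apply[OF GK]) (simp add: tensor_eval_def)
      qed
      show "?L e \<in> carrier (ell2 ?Z)" if "e \<in> carrier (ell2 ?Z)" for e using that by (rule closed)
      show "vdist (ell2 ?Z) (?L e) (?L f) = vdist (ell2 ?Z) e f"
        if "e \<in> carrier (ell2 ?Z)" "f \<in> carrier (ell2 ?Z)" for e f
      proof -
        \<comment> \<open>By linearity, preservation of distances reduces to preservation of the
          norm.\<close>
        have "(\<lambda>C. ?L e C - ?L f C) = ?L (\<lambda>C. e C - f C)"
          by (auto simp: quasi_regular_apply[OF GK])
        then show ?thesis
          using quasi_regular_closed(2)[OF GK g ell2_diff[OF that]] by (simp add: ell2_vdist)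
      qed
      show "e \<in> carrier (ell2 ?Z)" by (rule e)
    qed
    then show ?thesis
      using e inv_into_f_f[OF inj e(1)] inv_into_f_f[OF inj closed[OF e(1)]]
      by (simp add: tensor_phi_def quasi_regular_space[OF GH] quasi_regular_space[OF GH'])
  qed
  then show ?thesis
    unfolding unitarily_equivalent_def quasi_regular_space[OF GK] using U
    by (intro exI[of _ ?U]) (simp add: tensor_phi_def quasi_regular_space[OF GH] quasi_regular_space[OF GH'])
qed

end

section \<open>Equivalence, irreducibility and inequivalence for the subgroups
  \<open>Ksub\<close>\<close>

lemma unitarily_equivalent_refl: "unitarily_equivalent G \<pi> \<pi>"
  unfolding unitarily_equivalent_def unitary_map_def by (intro exI[of _ "\<lambda>v. v"]) (auto simp: bij_betw_def)

lemma gen_in_Ksub: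
  assumes "l \<in> {1..n * m}"
  shows "gen l \<in> Ksub n m l"
proof -
  obtain i j where ij: "i \<in> {1..n}" "j \<in> {1..m}" "l = m * (i - 1) + j" using assms by (rule index_cases)
  interpret group "FF (n * m)" by (rule group_free_group)
  show ?thesis
    using gen_pow_in_Ksub[OF ij, of 1] gen_in_free_group[OF assms] by simp
qed

theorem theorem3p4:
  fixes n m :: nat
  assumes "n \<ge> 1" and "m \<ge> 1"
  shows "(\<forall>i\<in>{1..n}. \<forall>j\<in>{1..m}.
            unitarily_equivalent (FF (n * m))
              (tensor_phi n m (quasi_regular (FF n) (Hsub n i)) (quasi_regular (FF m) (Hsub m j)))
              (quasi_regular (FF (n * m)) (Ksub n m (m * (i - 1) + j))))
       \<and> (\<forall>l\<in>{1..n * m}. irreducible_rep (FF (n * m)) (quasi_regular (FF (n * m)) (Ksub n m l)))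
       \<and> (\<forall>l\<in>{1..n * m}. \<forall>l'\<in>{1..n * m}.
            unitarily_equivalent (FF (n * m))
              (quasi_regular (FF (n * m)) (Ksub n m l)) (quasi_regular (FF (n * m)) (Ksub n m l'))
            \<longleftrightarrow> l = l')"
proof (intro conjI ballI)
  fix i j assume "i \<in> {1..n}" "j \<in> {1..m}"
  then show "unitarily_equivalent (FF (n * m))
      (tensor_phi n m (quasi_regular (FF n) (Hsub n i)) (quasi_regular (FF m) (Hsub m j)))
      (quasi_regular (FF (n * m)) (Ksub n m (m * (i - 1) + j)))"
    by (rule tensor_quasi_regular_equivalent[OF _ _ refl])
next
  fix l assume l: "l \<in> {1..n * m}"
  show "irreducible_rep (FF (n * m)) (quasi_regular (FF (n * m)) (Ksub n m l))"
    by (rule irreducible_quasi_regular[OF group_free_group subgroup_Ksub[OF l] gen_in_Ksub[OF l]])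
      (rule conj_gen_pow_in_Ksub(2)[OF l l])
next
  fix l l' assume l: "l \<in> {1..n * m}" "l' \<in> {1..n * m}"
  show "unitarily_equivalent (FF (n * m))
      (quasi_regular (FF (n * m)) (Ksub n m l)) (quasi_regular (FF (n * m)) (Ksub n m l')) \<longleftrightarrow> l = l'"
  proof
    assume eq: "unitarily_equivalent (FF (n * m))
      (quasi_regular (FF (n * m)) (Ksub n m l)) (quasi_regular (FF (n * m)) (Ksub n m l'))"
    show "l = l'"
    proof (rule ccontr)
      assume "l \<noteq> l'"
      \<comment> \<open>A conjugate of a positive power of \<open>gen l\<close> in
        \<open>Ksub n m l'\<close> would give \<open>l = l'\<close>, so for distinct indices none
        lies there and every orbit of \<open>gen l\<close> on these cosets is infinite.\<close>
      then have "\<not> unitarily_equivalent (FF (n * m))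
          (quasi_regular (FF (n * m)) (Ksub n m l)) (quasi_regular (FF (n * m)) (Ksub n m l'))"
        using conj_gen_pow_in_Ksub(1)[OF l]
        by (intro quasi_regular_not_equivalent[OF group_free_group subgroup_Ksub[OF l(1)]
              subgroup_Ksub[OF l(2)] gen_in_Ksub[OF l(1)]]) blast
      with eq show False by blast
    qed
  qed (simp add: unitarily_equivalent_refl)
qed

end
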